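(* Let $m\ge3$ be an odd integer and $n$ an integer with $2m<n$. Let $\lambda$ and $b$ be constants with $$0<\lambda<\frac{n}{n-2m},\qquad b=\frac{2m(n-2)}{n-\lambda(n-2m)}.$$ Let $\varphi:(1,\infty)\to(0,1)$ be continuous with $\lim_{r\to\infty}\varphi(r)=0$. Then there exists a $C^\infty$ positive solution $v$ of $$0\le-\Delta^m v\le v^\lambda\quad\text{in }\mathbb{R}^n\setminus\{0\}$$ such that $v(y)\neq O(\varphi(|y|)|y|^b)$ as $|y|\to\infty$.
   Context: $\Delta^m$ is the $m$-fold iterated Laplacian. For positive functions, "$v(y)\neq O(h(y))$ as $|y|\to\infty$" means $\limsup_{|y|\to\infty} v(y)/h(y)=\infty$. *)

theory Defs
  imports "HOL-Analysis.Analysis"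
begin

definition partial :: "'n::finite \<Rightarrow> (real^'n \<Rightarrow> real) \<Rightarrow> real^'n \<Rightarrow> real" where
  "partial i f x = deriv (\<lambda>t. f (x + t *\<^sub>R axis i 1)) 0"

fun iter_partial :: "'n::finite list \<Rightarrow> (real^'n \<Rightarrow> real) \<Rightarrow> real^'n \<Rightarrow> real" where
  "iter_partial [] f = f"
| "iter_partial (i # is) f = partial i (iter_partial is f)"

definition smooth_on :: "(real^'n::finite) set \<Rightarrow> (real^'n \<Rightarrow> real) \<Rightarrow> bool" where
  "smooth_on S f \<longleftrightarrow>
     (\<forall>is. continuous_on S (iter_partial is f) \<and>
        (\<forall>x\<in>S. \<forall>i. ((\<lambda>t. iter_partial is f (x + t *\<^sub>R axis i 1))
                    has_real_derivative iter_partial (i # is) f x) (at 0)))"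

definition laplacian :: "(real^'n::finite \<Rightarrow> real) \<Rightarrow> real^'n \<Rightarrow> real" where
  "laplacian f x = (\<Sum>i\<in>UNIV. partial i (partial i f) x)"

definition iter_laplacian :: "nat \<Rightarrow> (real^'n::finite \<Rightarrow> real) \<Rightarrow> real^'n \<Rightarrow> real" where
  "iter_laplacian m f = (laplacian ^^ m) f"

end

(* Write u = r^2 + |x - y|^2. The function u^(m - n/2) solves
     (-Delta)^m u^(m - n/2) = c r^(2m) u^(-m - n/2)  with c > 0,
   and since m is odd, -Delta^m = (-Delta)^m. A bubble of mass mu centred at y with |y| = R
   interacts with the origin like mu R^(2m-n), but once its Taylor polynomial at 0 of degree < 2m-2 (which is
   killed by Delta^m) is subtracted it is bounded below by -C mu R^(2-n) |x|^(2m-2). Hence one may superpose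
   infinitely many bubbles with masses mu_j = eps_j R_j^(n-2), sum eps_j = 1, and restore positivity by adding
   the polyharmonic polynomial (C+1) (1 + |x|^2)^(m-1). The width r_j is chosen so that the inequality
   for -Delta^m v just holds at the centre; the peak is then kappa_j R_j^b with kappa_j independent of R_j,
   so R_j can be taken so large that phi(R_j) is much smaller than kappa_j. Making each
   right-hand side at most eps_j v^lambda lets the inequality be summed for every lambda > 0.
   The bubble at scale S is written in terms of z = x / S with r^2 + |y|^2 = S^2. *)

theory Submission
  imports Defs
begin

section \<open>Smooth functions and their series\<close>

lemma iter_partial_append: "iter_partial (xs @ ys) f = iter_partial xs (iter_partial ys f)"
  by (induction xs) auto

text \<open>A family indexed by lists of directions, each member differentiating into the next, is
  forced to be the family of iterated partials of \<open>F []\<close>. Closure under sums, dilations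
  and series then amounts to writing down a candidate family and checking one differentiation
  step.\<close>

lemma smooth_systemI:
  fixes F :: "'n::finite list \<Rightarrow> real^'n \<Rightarrow> real"
  assumes "\<And>xs. continuous_on UNIV (F xs)"
    and "\<And>xs i x. ((\<lambda>t. F xs (x + t *\<^sub>R axis i 1)) has_real_derivative F (i # xs) x) (at 0)"
  shows "smooth_on UNIV (F [])" and "iter_partial xs (F []) = F xs"
proof -
  have eq: "iter_partial xs (F []) = F xs" for xs
  proof (induction xs)
    case (Cons i xs)
    show ?case
      using DERIV_imp_deriv[OF assms(2)[of xs _ i]] by (auto simp: Cons partial_def)
  qed simp
  show "smooth_on UNIV (F [])"
    unfolding smooth_on_def eq using assms by blast
  show "iter_partial xs (F []) = F xs" by (rule eq)
qed

lemma smooth_on_axis_deriv: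
  "smooth_on UNIV f \<Longrightarrow>
    ((\<lambda>t. iter_partial xs f (x + t *\<^sub>R axis i 1)) has_real_derivative iter_partial (i # xs) f x) (at 0)"
  unfolding smooth_on_def by blast

lemma smooth_on_continuous:
  "smooth_on UNIV f \<Longrightarrow> continuous_on UNIV (iter_partial xs f)"
  unfolding smooth_on_def by blast

lemma smooth_sum:
  fixes f :: "'k \<Rightarrow> real^'n::finite \<Rightarrow> real"
  assumes "\<And>k. k \<in> I \<Longrightarrow> smooth_on UNIV (f k)"
  shows "smooth_on UNIV (\<lambda>x. \<Sum>k\<in>I. f k x)"
    and "iter_partial xs (\<lambda>x. \<Sum>k\<in>I. f k x) = (\<lambda>x. \<Sum>k\<in>I. iter_partial xs (f k) x)"
proof -
  let ?F = "\<lambda>xs x. \<Sum>k\<in>I. iter_partial xs (f k) x"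
  have c: "continuous_on UNIV (?F xs)" for xs
    by (intro continuous_on_sum smooth_on_continuous assms)
  have d: "((\<lambda>t. ?F xs (x + t *\<^sub>R axis i 1)) has_real_derivative ?F (i # xs) x) (at 0)" for xs i x
    by (intro DERIV_sum smooth_on_axis_deriv assms)
  show "smooth_on UNIV (\<lambda>x. \<Sum>k\<in>I. f k x)"
    and "iter_partial xs (\<lambda>x. \<Sum>k\<in>I. f k x) = ?F xs"
    using smooth_systemI[of ?F, OF c d] by auto
qed

lemma smooth_lincomb:
  fixes f g :: "real^'n::finite \<Rightarrow> real"
  assumes "smooth_on UNIV f" "smooth_on UNIV g"
  shows "smooth_on UNIV (\<lambda>x. c * f x + d * g x)"
    and "iter_partial xs (\<lambda>x. c * f x + d * g x) = (\<lambda>x. c * iter_partial xs f x + d * iter_partial xs g x)"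
proof -
  let ?F = "\<lambda>xs x. c * iter_partial xs f x + d * iter_partial xs g x"
  have c: "continuous_on UNIV (?F xs)" for xs
    by (intro continuous_intros smooth_on_continuous assms)
  have d: "((\<lambda>t. ?F xs (x + t *\<^sub>R axis i 1)) has_real_derivative ?F (i # xs) x) (at 0)" for xs i x
    by (intro DERIV_add DERIV_cmult smooth_on_axis_deriv assms)
  show "smooth_on UNIV (\<lambda>x. c * f x + d * g x)" and "iter_partial xs (\<lambda>x. c * f x + d * g x) = ?F xs"
    using smooth_systemI[of ?F, OF c d] by auto
qed

lemma smooth_dilate:
  fixes f :: "real^'n::finite \<Rightarrow> real"
  assumes "smooth_on UNIV f"
  shows "smooth_on UNIV (\<lambda>x. c * f (s *\<^sub>R x))"
    and "iter_partial xs (\<lambda>x. c * f (s *\<^sub>R x)) = (\<lambda>x. c * s ^ length xs * iter_partial xs f (s *\<^sub>R x))"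
proof -
  let ?F = "\<lambda>xs x. c * s ^ length xs * iter_partial xs f (s *\<^sub>R x)"
  have c: "continuous_on UNIV (?F xs)" for xs
    by (intro continuous_intros continuous_on_compose2[OF smooth_on_continuous[OF assms]]) auto
  have d: "((\<lambda>t. ?F xs (x + t *\<^sub>R axis i 1)) has_real_derivative ?F (i # xs) x) (at 0)" for xs i x
  proof -
    have "((\<lambda>t. iter_partial xs f (s *\<^sub>R x + (s * t) *\<^sub>R axis i 1)) has_real_derivative
        iter_partial (i # xs) f (s *\<^sub>R x) * s) (at 0)"
    proof (rule DERIV_chain2[where g = "\<lambda>t. s * t"])
      show "((\<lambda>t. iter_partial xs f (s *\<^sub>R x + t *\<^sub>R axis i 1)) has_real_derivative
        iter_partial (i # xs) f (s *\<^sub>R x)) (at (s * 0))"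
        using smooth_on_axis_deriv[OF assms] by simp
      show "((*) s has_real_derivative s) (at 0)"
        by (auto intro!: derivative_eq_intros)
    qed
    from DERIV_cmult[OF this, of "c * s ^ length xs"] show ?thesis
      by (simp add: algebra_simps)
  qed
  show "smooth_on UNIV (\<lambda>x. c * f (s *\<^sub>R x))" and "iter_partial xs (\<lambda>x. c * f (s *\<^sub>R x)) = ?F xs"
    using smooth_systemI[of ?F, OF c d] by auto
qed

lemma smooth_partial:
  assumes "smooth_on UNIV f"
  shows "smooth_on UNIV (partial i f)"
proof -
  let ?F = "\<lambda>xs. iter_partial (xs @ [i]) f"
  have "smooth_on UNIV (?F [])"
    using smooth_on_continuous[OF assms] smooth_on_axis_deriv[OF assms, of "_ @ [i]"]
    by (intro smooth_systemI(1)) simp_all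
  then show ?thesis by simp
qed

lemma laplacian_eq: "laplacian f = (\<lambda>x. \<Sum>i\<in>UNIV. iter_partial [i, i] f x)"
  by (auto simp: laplacian_def)

lemma smooth_laplacian:
  assumes "smooth_on UNIV f"
  shows "smooth_on UNIV (laplacian f)"
    and "iter_partial xs (laplacian f) = (\<lambda>x. \<Sum>i\<in>UNIV. iter_partial (xs @ [i, i]) f x)"
proof -
  have s: "smooth_on UNIV (iter_partial [i, i] f)" for i
    using assms by (simp add: smooth_partial)
  show "smooth_on UNIV (laplacian f)"
    unfolding laplacian_eq by (rule smooth_sum(1)[OF s])
  show "iter_partial xs (laplacian f) = (\<lambda>x. \<Sum>i\<in>UNIV. iter_partial (xs @ [i, i]) f x)"
    unfolding laplacian_eq iter_partial_append by (rule smooth_sum(2)[OF s])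
qed

lemma iter_laplacian_0 [simp]: "iter_laplacian 0 f = f"
  and iter_laplacian_Suc: "iter_laplacian (Suc k) f = laplacian (iter_laplacian k f)"
  and iter_laplacian_Suc': "iter_laplacian (Suc k) f = iter_laplacian k (laplacian f)"
  by (simp_all add: iter_laplacian_def) (simp add: funpow_swap1)

lemma smooth_iter_laplacian: "smooth_on UNIV f \<Longrightarrow> smooth_on UNIV (iter_laplacian k f)"
  by (induction k) (auto simp: iter_laplacian_Suc smooth_laplacian)

lemma iter_laplacian_lincomb:
  assumes "smooth_on UNIV f" "smooth_on UNIV g"
  shows "iter_laplacian k (\<lambda>x. c * f x + d * g x) =
    (\<lambda>x. c * iter_laplacian k f x + d * iter_laplacian k g x)"
proof (induction k)
  case (Suc k)
  show ?case
    unfolding iter_laplacian_Suc Suc laplacian_eq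
    by (subst smooth_lincomb(2)) (auto simp: smooth_iter_laplacian assms sum.distrib sum_distrib_left)
qed simp

lemma iter_laplacian_dilate:
  assumes "smooth_on UNIV f"
  shows "iter_laplacian k (\<lambda>x. c * f (s *\<^sub>R x)) = (\<lambda>x. c * s ^ (2 * k) * iter_laplacian k f (s *\<^sub>R x))"
proof (induction k)
  case (Suc k)
  have "iter_laplacian (Suc k) (\<lambda>x. c * f (s *\<^sub>R x)) =
      (\<lambda>x. \<Sum>i\<in>UNIV. c * s ^ (2 * k) * s ^ length [i, i] * iter_partial [i, i] (iter_laplacian k f) (s *\<^sub>R x))"
    unfolding iter_laplacian_Suc Suc laplacian_eq smooth_dilate(2)[OF smooth_iter_laplacian[OF assms]] ..
  also have "\<dots> = (\<lambda>x. c * s ^ (2 * Suc k) * iter_laplacian (Suc k) f (s *\<^sub>R x))"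
    unfolding iter_laplacian_Suc laplacian_eq sum_distrib_left
    by (simp add: power2_eq_square mult_ac del: iter_partial.simps)
  finally show ?case .
qed simp

text \<open>This is the hypothesis of the Weierstrass test for all derivatives on all balls. The
  majorant concerns only late terms, because a rescaled Taylor remainder is controlled on a ball
  only once its scale is large compared with the radius.\<close>

definition locally_summable :: "(nat \<Rightarrow> real^'n::finite \<Rightarrow> real) \<Rightarrow> bool" where
  "locally_summable f \<longleftrightarrow> (\<forall>j. smooth_on UNIV (f j)) \<and>
    (\<forall>xs \<rho>. \<exists>M. summable M \<and>
      (\<forall>\<^sub>F j in sequentially. \<forall>x. norm x \<le> \<rho> \<longrightarrow> \<bar>iter_partial xs (f j) x\<bar> \<le> M j))"

lemma locally_summable_uniform:
  assumes "locally_summable f"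
  shows "uniform_limit {x. norm x \<le> \<rho>} (\<lambda>k x. \<Sum>j<k. iter_partial xs (f j) x)
           (\<lambda>x. \<Sum>j. iter_partial xs (f j) x) sequentially"
    and "summable (\<lambda>j. iter_partial xs (f j) x)"
proof -
  have *: "\<exists>M. summable M \<and>
      (\<forall>\<^sub>F j in sequentially. \<forall>x. norm x \<le> \<rho> \<longrightarrow> \<bar>iter_partial xs (f j) x\<bar> \<le> M j)" for \<rho>
    using assms unfolding locally_summable_def by blast
  from *[of \<rho>] obtain M where "summable M"
    "\<forall>\<^sub>F j in sequentially. \<forall>x\<in>{x. norm x \<le> \<rho>}. norm (iter_partial xs (f j) x) \<le> M j"
    by auto
  then show "uniform_limit {x. norm x \<le> \<rho>} (\<lambda>k x. \<Sum>j<k. iter_partial xs (f j) x)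
           (\<lambda>x. \<Sum>j. iter_partial xs (f j) x) sequentially"
    by (intro Weierstrass_m_test_ev)
  from *[of "norm x"] obtain M where M: "summable M" and
    ev: "\<forall>\<^sub>F j in sequentially. \<forall>y. norm y \<le> norm x \<longrightarrow> \<bar>iter_partial xs (f j) y\<bar> \<le> M j"
    by auto
  from ev have "\<forall>\<^sub>F j in sequentially. norm (iter_partial xs (f j) x) \<le> M j"
    by eventually_elim auto
  then show "summable (\<lambda>j. iter_partial xs (f j) x)"
    using M by (rule summable_comparison_test_ev)
qed

text \<open>The Weierstrass test gives uniform convergence of every differentiated series on balls.
  Continuity follows locally, and termwise differentiation reduces to the theorem for series in one
  real variable, applied along segments parallel to an axis.\<close>

lemma smooth_suminf:
  fixes f :: "nat \<Rightarrow> real^'n::finite \<Rightarrow> real"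
  assumes f: "locally_summable f"
  shows "smooth_on UNIV (\<lambda>x. \<Sum>j. f j x)"
    and "iter_partial xs (\<lambda>x. \<Sum>j. f j x) = (\<lambda>x. \<Sum>j. iter_partial xs (f j) x)"
proof -
  let ?F = "\<lambda>xs x. \<Sum>j. iter_partial xs (f j) x"
  have sm: "smooth_on UNIV (f j)" for j
    using f by (simp add: locally_summable_def)
  have c: "continuous_on UNIV (?F xs)" for xs
  proof -
    have *: "continuous_on {x. norm x \<le> \<rho>} (?F xs)" for \<rho>
    proof (rule uniform_limit_theorem[OF _ locally_summable_uniform(1)[OF f]])
      show "\<forall>\<^sub>F k in sequentially. continuous_on {x. norm x \<le> \<rho>} (\<lambda>x. \<Sum>j<k. iter_partial xs (f j) x)"
        by (intro always_eventually allI continuous_on_sum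
            continuous_on_subset[OF smooth_on_continuous[OF sm]]) auto
    qed simp
    have "continuous (at x) (?F xs)" for x
    proof -
      have "{y. norm y \<le> norm x + 1} = cball 0 (norm x + 1)"
        by auto
      have "x \<in> interior {y. norm y \<le> norm x + 1}"
        by (simp add: \<open>{y. norm y \<le> norm x + 1} = cball 0 (norm x + 1)\<close>)
      then show ?thesis
        by (rule continuous_on_interior[OF *])
    qed
    then show ?thesis
      by (simp add: continuous_at_imp_continuous_on)
  qed
  have d: "((\<lambda>t. ?F xs (x + t *\<^sub>R axis i 1)) has_real_derivative ?F (i # xs) x) (at 0)" for xs i x
  proof -
    let ?l = "\<lambda>t::real. x + t *\<^sub>R axis i 1"
    \<comment> \<open>Smoothness supplies derivatives only at parameter 0, so the base point is
      moved along the line.\<close>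
    have deriv: "((\<lambda>t. iter_partial xs (f j) (?l t)) has_real_derivative
        iter_partial (i # xs) (f j) (?l t)) (at t)" for j t
    proof -
      have "((\<lambda>s. iter_partial xs (f j) (?l t + s *\<^sub>R axis i 1)) has_real_derivative
          iter_partial (i # xs) (f j) (?l t)) (at (t - t))"
        using smooth_on_axis_deriv[OF sm] by simp
      from this have "((\<lambda>s. iter_partial xs (f j) (?l t + (s - t) *\<^sub>R axis i 1)) has_real_derivative
          iter_partial (i # xs) (f j) (?l t) * 1) (at t)"
        by (rule DERIV_chain2[where f = "\<lambda>s. iter_partial xs (f j) (?l t + s *\<^sub>R axis i 1)"
              and g = "\<lambda>s. s - t"]) (auto intro!: derivative_eq_intros)
      then show ?thesis
        by (simp add: scaleR_left_diff_distrib)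
    qed
    have U: "uniform_limit {y. norm y \<le> norm x + 1} (\<lambda>k x. \<Sum>j<k. iter_partial (i # xs) (f j) x)
           (?F (i # xs)) sequentially"
      by (rule locally_summable_uniform[OF f])
    \<comment> \<open>The segment stays in a fixed ball, so uniform convergence on the ball
      restricts to it.\<close>
    have sub: "?l t \<in> {y. norm y \<le> norm x + 1}" if "t \<in> cball 0 1" for t
    proof -
      have "norm (?l t) \<le> norm x + norm (t *\<^sub>R (axis i 1 :: real^'n))"
        by (rule norm_triangle_ineq)
      then show ?thesis using that by simp
    qed
    have u: "uniform_limit (cball 0 1) (\<lambda>k t. \<Sum>j<k. iter_partial (i # xs) (f j) (?l t))
        (\<lambda>t. ?F (i # xs) (?l t)) sequentially"
      unfolding uniform_limit_iff
    proof (intro allI impI)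
      fix e :: real
      assume "e > 0"
      from uniform_limitD[OF U this]
      show "\<forall>\<^sub>F k in sequentially. \<forall>t\<in>cball 0 1.
          dist (\<Sum>j<k. iter_partial (i # xs) (f j) (?l t)) (?F (i # xs) (?l t)) < e"
        by (rule eventually_mono) (use sub in blast)
    qed
    have "((\<lambda>t. \<Sum>j. iter_partial xs (f j) (?l t)) has_real_derivative ?F (i # xs) (?l 0)) (at 0)"
    proof (rule has_field_derivative_series'(2)[where S = "cball 0 1"
          and f = "\<lambda>j t. iter_partial xs (f j) (?l t)"
          and f' = "\<lambda>j t. iter_partial (i # xs) (f j) (?l t)", OF convex_cball _ uniformly_convergentI[OF u]])
      show "((\<lambda>t. iter_partial xs (f j) (?l t)) has_real_derivative
        iter_partial (i # xs) (f j) (?l t)) (at t within cball 0 1)" for j t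
        by (rule has_field_derivative_at_within[OF deriv])
      show "(0::real) \<in> cball 0 1" "summable (\<lambda>j. iter_partial xs (f j) (?l 0))" "(0::real) \<in> interior (cball 0 1)"
        by (auto simp: locally_summable_uniform[OF f])
    qed
    then show ?thesis
      by (simp del: iter_partial.simps)
  qed
  show "smooth_on UNIV (\<lambda>x. \<Sum>j. f j x)" and "iter_partial xs (\<lambda>x. \<Sum>j. f j x) = ?F xs"
    using smooth_systemI[of ?F, OF c d] by auto
qed

lemma locally_summable_laplacian:
  fixes f :: "nat \<Rightarrow> real^'n::finite \<Rightarrow> real"
  assumes f: "locally_summable f"
  shows "locally_summable (\<lambda>j. laplacian (f j))"
    and "laplacian (\<lambda>x. \<Sum>j. f j x) = (\<lambda>x. \<Sum>j. laplacian (f j) x)"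
proof -
  have sm: "smooth_on UNIV (f j)" for j
    using f by (simp add: locally_summable_def)
  have "\<exists>M. summable M \<and>
      (\<forall>\<^sub>F j in sequentially. \<forall>x. norm x \<le> \<rho> \<longrightarrow> \<bar>iter_partial xs (laplacian (f j)) x\<bar> \<le> M j)" for xs \<rho>
  proof -
    have "\<forall>i. \<exists>M. summable M \<and>
      (\<forall>\<^sub>F j in sequentially. \<forall>x. norm x \<le> \<rho> \<longrightarrow> \<bar>iter_partial (xs @ [i, i]) (f j) x\<bar> \<le> M j)"
      using f unfolding locally_summable_def by blast
    from choice[OF this] obtain M where M: "\<And>i. summable (M i)"
      "\<And>i. \<forall>\<^sub>F j in sequentially. \<forall>x. norm x \<le> \<rho> \<longrightarrow> \<bar>iter_partial (xs @ [i, i]) (f j) x\<bar> \<le> M i j"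
      by blast
    have "\<forall>\<^sub>F j in sequentially. \<forall>i. \<forall>x. norm x \<le> \<rho> \<longrightarrow> \<bar>iter_partial (xs @ [i, i]) (f j) x\<bar> \<le> M i j"
      using M(2) by (simp add: eventually_all_finite)
    then have "\<forall>\<^sub>F j in sequentially. \<forall>x. norm x \<le> \<rho> \<longrightarrow>
        \<bar>iter_partial xs (laplacian (f j)) x\<bar> \<le> (\<Sum>i\<in>UNIV. M i j)"
      by eventually_elim (auto simp: smooth_laplacian(2)[OF sm] intro!: order_trans[OF sum_abs] sum_mono)
    moreover have "summable (\<lambda>j. \<Sum>i\<in>UNIV. M i j)"
      by (intro summable_sum M)
    ultimately show ?thesis by blast
  qed
  then show "locally_summable (\<lambda>j. laplacian (f j))"
    unfolding locally_summable_def using smooth_laplacian(1)[OF sm] by blast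
  show "laplacian (\<lambda>x. \<Sum>j. f j x) = (\<lambda>x. \<Sum>j. laplacian (f j) x)"
    unfolding laplacian_eq smooth_suminf(2)[OF f]
    by (subst suminf_sum) (auto simp del: iter_partial.simps intro: locally_summable_uniform(2)[OF f])
qed

text \<open>Local summability is carried along in the induction, since it is what permits the next
  interchange of Laplacian and sum.\<close>

lemma iter_laplacian_suminf:
  assumes "locally_summable f"
  shows "iter_laplacian k (\<lambda>x. \<Sum>j. f j x) = (\<lambda>x. \<Sum>j. iter_laplacian k (f j) x)"
    and "summable (\<lambda>j. iter_laplacian k (f j) x)"
proof -
  have *: "locally_summable (\<lambda>j. iter_laplacian k (f j)) \<and>
    iter_laplacian k (\<lambda>x. \<Sum>j. f j x) = (\<lambda>x. \<Sum>j. iter_laplacian k (f j) x)" for k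
    by (induction k) (auto simp: assms iter_laplacian_Suc locally_summable_laplacian)
  then show "iter_laplacian k (\<lambda>x. \<Sum>j. f j x) = (\<lambda>x. \<Sum>j. iter_laplacian k (f j) x)" by blast
  show "summable (\<lambda>j. iter_laplacian k (f j) x)"
    using locally_summable_uniform(2)[OF conjunct1[OF *], of "[]"] by simp
qed

section \<open>Taylor remainders\<close>

lemma has_derivative_axis:
  fixes f :: "real^'n::finite \<Rightarrow> real"
  assumes "(f has_derivative (\<lambda>h. \<Sum>i\<in>UNIV. h $ i * g i)) (at x)"
  shows "((\<lambda>t. f (x + t *\<^sub>R axis i 1)) has_real_derivative g i) (at 0)"
proof -
  have "((\<lambda>t. x + t *\<^sub>R axis i (1::real)) has_derivative (\<lambda>t. t *\<^sub>R axis i 1)) (at 0)"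
    by (auto intro!: derivative_eq_intros)
  then have "((\<lambda>t. f (x + t *\<^sub>R axis i 1)) has_derivative
      (\<lambda>t. \<Sum>k\<in>UNIV. (t *\<^sub>R axis i (1::real)) $ k * g k)) (at 0)"
    by (rule has_derivative_compose) (use assms in simp)
  moreover have "(\<Sum>k\<in>UNIV. (t *\<^sub>R axis i (1::real)) $ k * g k) = t * g i" for t
    by (subst sum.remove[of _ i]) (auto simp: axis_def intro!: sum.neutral)
  ultimately show ?thesis
    by (simp add: has_field_derivative_def mult_commute_abs)
qed

text \<open>Stronger than \<^const>\<open>smooth_on\<close> on the whole space: total derivatives and equality of mixed
  partials are built in, so that neither has to be derived from continuity of the partials.\<close>

definition fsmooth :: "(real^'n::finite \<Rightarrow> real) \<Rightarrow> bool" where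
  "fsmooth f \<longleftrightarrow>
    (\<forall>xs x. (iter_partial xs f has_derivative (\<lambda>h. \<Sum>i\<in>UNIV. h $ i * iter_partial (i # xs) f x)) (at x)) \<and>
    (\<forall>xs i j. iter_partial (i # j # xs) f = iter_partial (j # i # xs) f)"

lemma fsmooth_systemI:
  fixes F :: "'n::finite list \<Rightarrow> real^'n \<Rightarrow> real"
  assumes "\<And>xs x. (F xs has_derivative (\<lambda>h. \<Sum>i\<in>UNIV. h $ i * F (i # xs) x)) (at x)"
    and "\<And>xs i j. F (i # j # xs) = F (j # i # xs)"
  shows "fsmooth (F [])" and "iter_partial xs (F []) = F xs" and "smooth_on UNIV (F [])"
proof -
  have c: "continuous_on UNIV (F xs)" for xs
    by (intro continuous_at_imp_continuous_on ballI has_derivative_continuous[OF assms(1)])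
  have d: "((\<lambda>t. F xs (x + t *\<^sub>R axis i 1)) has_real_derivative F (i # xs) x) (at 0)" for xs i x
    by (rule has_derivative_axis[OF assms(1)])
  note eq = smooth_systemI(2)[of F, OF c d]
  show "iter_partial xs (F []) = F xs" by (rule eq)
  show "smooth_on UNIV (F [])" by (rule smooth_systemI(1)[of F, OF c d])
  show "fsmooth (F [])"
    unfolding fsmooth_def eq using assms by blast
qed

lemma fsmooth_deriv:
  "fsmooth f \<Longrightarrow>
    (iter_partial xs f has_derivative (\<lambda>h. \<Sum>i\<in>UNIV. h $ i * iter_partial (i # xs) f x)) (at x)"
  unfolding fsmooth_def by blast

lemma fsmooth_deriv1:
  "fsmooth f \<Longrightarrow> (f has_derivative (\<lambda>h. \<Sum>i\<in>UNIV. h $ i * partial i f x)) (at x)"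
  using fsmooth_deriv[of f "[]" x] by simp

lemma fsmooth_swap:
  "fsmooth f \<Longrightarrow> iter_partial (i # j # xs) f = iter_partial (j # i # xs) f"
  unfolding fsmooth_def by blast

lemma fsmooth_commute: "fsmooth f \<Longrightarrow> partial i (partial j f) = partial j (partial i f)"
  using fsmooth_swap[of f i j "[]"] by simp

lemma fsmooth_imp_smooth: "fsmooth f \<Longrightarrow> smooth_on UNIV f"
  using fsmooth_systemI(3)[of "\<lambda>xs. iter_partial xs f", OF fsmooth_deriv fsmooth_swap] by simp

lemma fsmooth_iter_partial:
  assumes "fsmooth f"
  shows "fsmooth (iter_partial ys f)"
proof -
  let ?F = "\<lambda>xs. iter_partial (xs @ ys) f"
  have "fsmooth (?F [])"
    using fsmooth_deriv[OF assms, of "_ @ ys"] fsmooth_swap[OF assms, of _ _ "_ @ ys"]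
    by (intro fsmooth_systemI(1)) simp_all
  then show ?thesis by simp
qed

lemma fsmooth_partial: "fsmooth f \<Longrightarrow> fsmooth (partial i f)"
  using fsmooth_iter_partial[of f "[i]"] by simp

lemma fsmooth_sum:
  fixes f :: "'k \<Rightarrow> real^'n::finite \<Rightarrow> real"
  assumes "\<And>k. k \<in> I \<Longrightarrow> fsmooth (f k)"
  shows "fsmooth (\<lambda>x. \<Sum>k\<in>I. f k x)"
proof -
  let ?F = "\<lambda>xs x. \<Sum>k\<in>I. iter_partial xs (f k) x"
  have "(?F xs has_derivative (\<lambda>h. \<Sum>i\<in>UNIV. h $ i * ?F (i # xs) x)) (at x)" for xs x
  proof -
    have "(?F xs has_derivative (\<lambda>h. \<Sum>k\<in>I. \<Sum>i\<in>UNIV. h $ i * iter_partial (i # xs) (f k) x)) (at x)"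
      by (intro has_derivative_sum fsmooth_deriv assms)
    then show ?thesis
      unfolding sum_distrib_left by (subst sum.swap)
  qed
  moreover have "?F (i # j # xs) = ?F (j # i # xs)" for xs i j
    using fsmooth_swap[OF assms] by (intro ext sum.cong refl) metis
  ultimately show ?thesis
    using fsmooth_systemI(1)[of ?F] by (simp del: iter_partial.simps(2))
qed

lemma fsmooth_laplacian: "fsmooth f \<Longrightarrow> fsmooth (laplacian f)"
  unfolding laplacian_eq by (intro fsmooth_sum fsmooth_iter_partial)

lemma fsmooth_iter_laplacian: "fsmooth f \<Longrightarrow> fsmooth (iter_laplacian k f)"
  by (induction k) (auto simp: iter_laplacian_Suc fsmooth_laplacian)

text \<open>\<open>taylor_form k f z\<close> is the \<open>k\<close>-th derivative of \<open>t \<mapsto> f (t z)\<close> at \<open>0\<close>. Peeling off one partial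
  derivative at a time makes the Taylor remainder of order \<open>M\<close> of \<open>f\<close> have as partials the remainders
  of order \<open>M - 1\<close> of the partials of \<open>f\<close>, where truncated subtraction is correct because
  the remainder of order \<open>0\<close> is \<open>f\<close> itself.\<close>

fun taylor_form :: "nat \<Rightarrow> (real^'n::finite \<Rightarrow> real) \<Rightarrow> real^'n \<Rightarrow> real" where
  "taylor_form 0 f z = f 0"
| "taylor_form (Suc k) f z = (\<Sum>i\<in>UNIV. z $ i * taylor_form k (partial i f) z)"

definition taylor_rem :: "nat \<Rightarrow> (real^'n::finite \<Rightarrow> real) \<Rightarrow> real^'n \<Rightarrow> real" where
  "taylor_rem M f z = f z - (\<Sum>k<M. taylor_form k f z / fact k)"

text \<open>The product rule yields \<open>k\<close> copies from the inner form and one from the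
  coordinate in front, and commuting partials make them all alike. At degree 0 the factor
  \<open>real k\<close> vanishes, so the truncated \<open>k - 1\<close> is harmless.\<close>

lemma has_derivative_taylor_form:
  assumes "fsmooth f"
  shows "(taylor_form k f has_derivative
    (\<lambda>h. \<Sum>j\<in>UNIV. h $ j * (real k * taylor_form (k - 1) (partial j f) z))) (at z)"
  using assms
proof (induction k arbitrary: f)
  case 0
  have "taylor_form 0 f = (\<lambda>z. f 0)" by auto
  then show ?case by simp
next
  case (Suc k)
  have eq: "taylor_form (Suc k) f = (\<lambda>z. \<Sum>i\<in>UNIV. z $ i * taylor_form k (partial i f) z)"
    by auto
  have vec: "((\<lambda>z::real^'a. z $ i) has_derivative (\<lambda>h. h $ i)) (at z)" for i
    by (intro bounded_linear_imp_has_derivative bounded_linear_vec_nth)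
  have "(taylor_form (Suc k) f has_derivative (\<lambda>h. \<Sum>i\<in>UNIV.
      z $ i * (\<Sum>j\<in>UNIV. h $ j * (real k * taylor_form (k - 1) (partial j (partial i f)) z)) +
      h $ i * taylor_form k (partial i f) z)) (at z)"
    unfolding eq by (intro has_derivative_sum has_derivative_mult vec Suc.IH fsmooth_partial Suc.prems)
  moreover have "(\<Sum>i\<in>UNIV.
      z $ i * (\<Sum>j\<in>UNIV. h $ j * (real k * taylor_form (k - 1) (partial j (partial i f)) z)) +
      h $ i * taylor_form k (partial i f) z) =
    (\<Sum>j\<in>UNIV. h $ j * (real (Suc k) * taylor_form k (partial j f) z))" for h
  proof -
    have "(\<Sum>i\<in>UNIV. z $ i * (\<Sum>j\<in>UNIV. h $ j * (real k * taylor_form (k - 1) (partial j (partial i f)) z)))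
      = (\<Sum>j\<in>UNIV. \<Sum>i\<in>UNIV. h $ j * (real k * (z $ i * taylor_form (k - 1) (partial i (partial j f)) z)))"
      unfolding sum_distrib_left
      by (subst sum.swap) (simp add: fsmooth_commute[OF Suc.prems] mult_ac)
    also have "\<dots> = (\<Sum>j\<in>UNIV. h $ j * (real k * taylor_form k (partial j f) z))"
      by (cases k) (simp_all add: sum_distrib_left)
    finally show ?thesis
      by (simp add: sum.distrib algebra_simps)
  qed
  ultimately show ?case
    by (simp del: taylor_form.simps)
qed

text \<open>Differentiation turns 1/k! into 1/(k-1)!, so the Taylor sum of \<open>f\<close> goes
  over into the Taylor sums of its partials with one term fewer.\<close>

lemma has_derivative_taylor_rem:
  assumes "fsmooth f"
  shows "(taylor_rem M f has_derivative
    (\<lambda>h. \<Sum>j\<in>UNIV. h $ j * taylor_rem (M - 1) (partial j f) z)) (at z)"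
proof -
  have eq: "taylor_rem M f = (\<lambda>z. f z - (\<Sum>k<M. taylor_form k f z / fact k))"
    by (auto simp: taylor_rem_def)
  have "(taylor_rem M f has_derivative (\<lambda>h. (\<Sum>j\<in>UNIV. h $ j * partial j f z) -
      (\<Sum>k<M. (\<Sum>j\<in>UNIV. h $ j * (real k * taylor_form (k - 1) (partial j f) z)) / fact k))) (at z)"
    unfolding eq divide_inverse
    by (intro has_derivative_diff has_derivative_sum has_derivative_mult_left
        has_derivative_taylor_form fsmooth_deriv1 assms) 
  moreover have "(\<Sum>j\<in>UNIV. h $ j * partial j f z) -
      (\<Sum>k<M. (\<Sum>j\<in>UNIV. h $ j * (real k * taylor_form (k - 1) (partial j f) z)) / fact k) =
    (\<Sum>j\<in>UNIV. h $ j * taylor_rem (M - 1) (partial j f) z)" for h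
  proof -
    have "(\<Sum>k<M. real k * taylor_form (k - 1) g z / fact k) = (\<Sum>k<M - 1. taylor_form k g z / fact k)" for g :: "real^'a \<Rightarrow> real"
    proof (cases M)
      case (Suc N)
      show ?thesis
        unfolding Suc sum.lessThan_Suc_shift
        by (simp add: fact_Suc divide_simps del: of_nat_Suc)
    qed simp
    then have "taylor_rem (M - 1) g z = g z - (\<Sum>k<M. real k * taylor_form (k - 1) g z / fact k)" for g :: "real^'a \<Rightarrow> real"
      by (simp add: taylor_rem_def)
    then show ?thesis
      by (simp add: right_diff_distrib sum_subtractf sum_divide_distrib sum_distrib_left)
        (subst sum.swap, simp)
  qed
  ultimately show ?thesis by simp
qed

lemma iter_partial_taylor_rem:
  assumes "fsmooth f"
  shows "fsmooth (taylor_rem M f)"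
    and "iter_partial xs (taylor_rem M f) = taylor_rem (M - length xs) (iter_partial xs f)"
proof -
  let ?F = "\<lambda>xs. taylor_rem (M - length xs) (iter_partial xs f)"
  have d: "(?F xs has_derivative (\<lambda>h. \<Sum>i\<in>UNIV. h $ i * ?F (i # xs) x)) (at x)" for xs x
    using has_derivative_taylor_rem[OF fsmooth_iter_partial[OF assms], of "M - length xs" xs x] by simp
  have c: "?F (i # j # xs) = ?F (j # i # xs)" for xs i j
    by (simp only: fsmooth_swap[OF assms, of i j xs] list.size)
  show "fsmooth (taylor_rem M f)" "iter_partial xs (taylor_rem M f) = ?F xs"
    using fsmooth_systemI(1,2)[of ?F, OF d c] by auto
qed

lemma taylor_form_sum:
  assumes "\<And>i. i \<in> I \<Longrightarrow> smooth_on UNIV (f i)"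
  shows "taylor_form k (\<lambda>x. \<Sum>i\<in>I. f i x) z = (\<Sum>i\<in>I. taylor_form k (f i) z)"
  using assms
proof (induction k arbitrary: f)
  case (Suc k)
  have "partial j (\<lambda>x. \<Sum>i\<in>I. f i x) = (\<lambda>x. \<Sum>i\<in>I. partial j (f i) x)" for j
    using smooth_sum(2)[of I f "[j]"] Suc.prems by simp
  then have "taylor_form (Suc k) (\<lambda>x. \<Sum>i\<in>I. f i x) z =
      (\<Sum>j\<in>UNIV. z $ j * (\<Sum>i\<in>I. taylor_form k (partial j (f i)) z))"
    by (simp add: Suc.IH smooth_partial Suc.prems)
  also have "\<dots> = (\<Sum>i\<in>I. taylor_form (Suc k) (f i) z)"
    unfolding sum_distrib_left by (subst sum.swap) simp
  finally show ?case .
qed simp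

lemma taylor_rem_sum:
  assumes "\<And>i. i \<in> I \<Longrightarrow> smooth_on UNIV (f i)"
  shows "taylor_rem M (\<lambda>x. \<Sum>i\<in>I. f i x) z = (\<Sum>i\<in>I. taylor_rem M (f i) z)"
proof -
  have "(\<Sum>k<M. taylor_form k (\<lambda>x. \<Sum>i\<in>I. f i x) z / fact k) =
      (\<Sum>i\<in>I. \<Sum>k<M. taylor_form k (f i) z / fact k)"
    by (subst sum.swap) (simp add: taylor_form_sum assms sum_divide_distrib)
  then show ?thesis
    by (simp add: taylor_rem_def sum_subtractf)
qed

text \<open>Each Laplacian lowers the order by two. Once \<open>2 * k\<close> reaches
  \<open>M\<close> the order is 0 and the subtracted polynomial has disappeared; this is how the
  correction stays invisible to the iterated Laplacian.\<close>

lemma iter_laplacian_taylor_rem: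
  assumes "fsmooth f"
  shows "iter_laplacian k (taylor_rem M f) = taylor_rem (M - 2 * k) (iter_laplacian k f)"
proof (induction k)
  case (Suc k)
  let ?g = "iter_laplacian k f"
  have g: "fsmooth ?g"
    by (rule fsmooth_iter_laplacian[OF assms])
  have "iter_partial [i, i] (taylor_rem (M - 2 * k) ?g) = taylor_rem (M - 2 * Suc k) (iter_partial [i, i] ?g)" for i
    using iter_partial_taylor_rem(2)[OF g, of "[i, i]"] by (simp add: diff_diff_eq add.commute numeral_2_eq_2)
  then show ?case
    unfolding iter_laplacian_Suc Suc laplacian_eq
    by (auto simp del: iter_partial.simps
        intro!: taylor_rem_sum[symmetric] fsmooth_imp_smooth fsmooth_iter_partial g)
qed simp

section \<open>Bubbles\<close>

text \<open>For \<open>norm p < 1\<close> this is \<open>r\<^sup>2 + |z - p|\<^sup>2\<close> with \<open>r\<^sup>2 = 1 - |p|\<^sup>2\<close>; the normalisation makes the value at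
  \<open>0\<close> equal to \<open>1\<close>.\<close>

definition bubble :: "real^'n::finite \<Rightarrow> real^'n \<Rightarrow> real" where
  "bubble p z = 1 - (norm p)\<^sup>2 + (norm (z - p))\<^sup>2"

lemma bubble_ge: "1 - (norm p)\<^sup>2 \<le> bubble p z"
  by (simp add: bubble_def)

lemma bubble_pos: "norm p < 1 \<Longrightarrow> 0 < bubble p z"
  using bubble_ge[of p z] by (smt (verit) norm_ge_zero power_less_one_iff zero_less_numeral power_one power_strict_mono pos2)

lemma bubble_alt: "bubble p z = 1 - 2 * (z \<bullet> p) + (norm z)\<^sup>2"
  by (simp add: bubble_def power2_norm_eq_inner inner_diff inner_commute)

text \<open>By Cauchy-Schwarz the bubble is at least (1 - |z|)^2. The bounds therefore do not
  deteriorate as \<open>p\<close> approaches the unit sphere, where the bubble degenerates at its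
  own centre.\<close>

lemma bubble_bounds:
  assumes "norm p < 1" "norm z \<le> 1/2"
  shows "1/4 \<le> bubble p z" "bubble p z \<le> 4"
proof -
  have "\<bar>z \<bullet> p\<bar> \<le> norm z * norm p"
    by (rule Cauchy_Schwarz_ineq2)
  also have "\<dots> \<le> norm z * 1"
    using assms by (intro mult_left_mono) auto
  finally have *: "\<bar>z \<bullet> p\<bar> \<le> norm z" by simp
  have "(1/2)\<^sup>2 \<le> (1 - norm z)\<^sup>2"
    using assms by (intro power_mono) auto
  then show "1/4 \<le> bubble p z"
    using * by (simp add: bubble_alt power2_eq_square algebra_simps)
  have "(norm z)\<^sup>2 \<le> (1/2)\<^sup>2"
    using assms by (intro power_mono) auto
  then show "bubble p z \<le> 4"
    using * assms by (simp add: bubble_alt power2_eq_square)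
qed

lemma has_derivative_bubble:
  "(bubble p has_derivative (\<lambda>h. \<Sum>i\<in>UNIV. h $ i * (2 * (z $ i - p $ i)))) (at z)"
proof -
  have "((\<lambda>z. 1 - (norm p)\<^sup>2 + (z - p) \<bullet> (z - p)) has_derivative (\<lambda>h. 0 + ((z - p) \<bullet> (h - 0) + (h - 0) \<bullet> (z - p)))) (at z)"
    by (intro derivative_intros)
  moreover have "bubble p = (\<lambda>z. 1 - (norm p)\<^sup>2 + (z - p) \<bullet> (z - p))"
    by (auto simp: bubble_def power2_norm_eq_inner)
  moreover have "(\<lambda>h. 0 + ((z - p) \<bullet> (h - 0) + (h - 0) \<bullet> (z - p))) = (\<lambda>h. \<Sum>i\<in>UNIV. h $ i * (2 * (z $ i - p $ i)))"
    by (auto simp: inner_vec_def sum.distrib[symmetric] algebra_simps intro!: sum.cong)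
  ultimately show ?thesis by simp
qed

text \<open>Syntax for the algebra generated by the powers of the bubble and closed under partial derivatives:
  induction over it gives bounds on all derivatives that are uniform in the parameter \<open>p\<close>.\<close>

datatype 'n bexpr = BConst real | BCoord 'n | BPow real | BAdd "'n bexpr" "'n bexpr" | BMul "'n bexpr" "'n bexpr"

primrec beval :: "real^'n::finite \<Rightarrow> 'n bexpr \<Rightarrow> real^'n \<Rightarrow> real" where
  "beval p (BConst c) = (\<lambda>z. c)"
| "beval p (BCoord i) = (\<lambda>z. z $ i - p $ i)"
| "beval p (BPow q) = (\<lambda>z. bubble p z powr q)"
| "beval p (BAdd a b) = (\<lambda>z. beval p a z + beval p b z)"
| "beval p (BMul a b) = (\<lambda>z. beval p a z * beval p b z)"

primrec bderiv :: "'n \<Rightarrow> 'n bexpr \<Rightarrow> 'n bexpr" where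
  "bderiv i (BConst c) = BConst 0"
| "bderiv i (BCoord j) = BConst (if i = j then 1 else 0)"
| "bderiv i (BPow q) = BMul (BConst (2 * q)) (BMul (BCoord i) (BPow (q - 1)))"
| "bderiv i (BAdd a b) = BAdd (bderiv i a) (bderiv i b)"
| "bderiv i (BMul a b) = BAdd (BMul (bderiv i a) b) (BMul a (bderiv i b))"

lemma has_derivative_beval:
  assumes p: "norm p < 1"
  shows "(beval p e has_derivative (\<lambda>h. \<Sum>i\<in>UNIV. h $ i * beval p (bderiv i e) z)) (at z)"
proof (induction e)
  case (BCoord j)
  have "(\<Sum>i\<in>UNIV. h $ i * (if i = j then 1 else 0)) = h $ j" for h :: "real^'a"
    by (subst sum.remove[of _ j]) (auto intro!: sum.neutral)
  moreover have "((\<lambda>z. z $ j - p $ j) has_derivative (\<lambda>h. h $ j - 0)) (at z)"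
    by (intro has_derivative_diff has_derivative_const bounded_linear_imp_has_derivative bounded_linear_vec_nth)
  ultimately show ?case by simp
next
  case (BPow q)
  have "((\<lambda>z. bubble p z powr q) has_derivative
      (\<lambda>h. (\<Sum>i\<in>UNIV. h $ i * (2 * (z $ i - p $ i))) * (q * bubble p z powr (q - 1)))) (at z)"
    by (rule DERIV_compose_FDERIV[OF has_real_derivative_powr has_derivative_bubble])
      (rule bubble_pos[OF p])
  moreover have "(\<Sum>i\<in>UNIV. h $ i * (2 * (z $ i - p $ i))) * (q * bubble p z powr (q - 1)) =
      (\<Sum>i\<in>UNIV. h $ i * beval p (bderiv i (BPow q)) z)" for h
    unfolding sum_distrib_right by (intro sum.cong) auto
  ultimately show ?case by simp
next
  case (BAdd a b)
  then show ?case
    using has_derivative_add[OF BAdd] by (simp add: sum.distrib algebra_simps)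
next
  case (BMul a b)
  have "(\<lambda>h. beval p a z * (\<Sum>i\<in>UNIV. h $ i * beval p (bderiv i b) z) + (\<Sum>i\<in>UNIV. h $ i * beval p (bderiv i a) z) * beval p b z)
      = (\<lambda>h. \<Sum>i\<in>UNIV. h $ i * beval p (bderiv i (BMul a b)) z)"
    by (auto simp: sum_distrib_left sum_distrib_right sum.distrib[symmetric] algebra_simps)
  then show ?case
    using has_derivative_mult[OF BMul] by simp
qed simp

text \<open>The product rule produces different syntax trees for the two orders, so the symmetry is
  available only after evaluation.\<close>

lemma beval_bderiv_commute: "beval p (bderiv i (bderiv j e)) = beval p (bderiv j (bderiv i e))"
proof (induction e)
  case (BAdd a b)
  then show ?case by simp
next
  case (BMul a b)
  show ?case
    using fun_cong[OF BMul(1)] fun_cong[OF BMul(2)] by (auto simp: algebra_simps)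
qed (auto simp: algebra_simps)

lemma
  assumes "norm p < 1"
  shows fsmooth_beval: "fsmooth (beval p e)" and partial_beval: "partial i (beval p e) = beval p (bderiv i e)"
proof -
  let ?F = "\<lambda>xs. beval p (foldr bderiv xs e)"
  have d: "(?F xs has_derivative (\<lambda>h. \<Sum>i\<in>UNIV. h $ i * ?F (i # xs) x)) (at x)" for xs x
    using has_derivative_beval[OF assms] by simp
  have c: "?F (i # j # xs) = ?F (j # i # xs)" for xs i j
    by (simp add: beval_bderiv_commute)
  show "fsmooth (beval p e)" "partial i (beval p e) = beval p (bderiv i e)"
    using fsmooth_systemI(1)[of ?F, OF d c] fsmooth_systemI(2)[of ?F "[i]", OF d c] by auto
qed

lemma fsmooth_bubble_powr: "norm p < 1 \<Longrightarrow> fsmooth (\<lambda>z. bubble p z powr q)"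
  using fsmooth_beval[of p "BPow q"] by simp

lemma smooth_bubble_powr: "norm p < 1 \<Longrightarrow> smooth_on UNIV (\<lambda>z. bubble p z powr q)"
  by (intro fsmooth_imp_smooth fsmooth_bubble_powr)

section \<open>Laplacians of powers of the bubble\<close>

lemma laplacian_cmult:
  assumes "smooth_on UNIV f"
  shows "laplacian (\<lambda>x. c * f x) = (\<lambda>x. c * laplacian f x)"
  using iter_laplacian_lincomb[OF assms assms, of 1 c 0] by (simp add: iter_laplacian_Suc)

text \<open>The second partials sum to an expression in |z - p|^2, which is the bubble minus the
  constant 1 - |p|^2; hence only two lower powers remain.\<close>

lemma laplacian_bubble_powr:
  fixes p :: "real^'n::finite"
  assumes p: "norm p < 1"
  shows "laplacian (\<lambda>z. bubble p z powr q) =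
    (\<lambda>z. 2 * q * (2 * q - 2 + CARD('n)) * bubble p z powr (q - 1) +
         (- 4 * q * (q - 1) * (1 - (norm p)\<^sup>2)) * bubble p z powr (q - 2))"
proof
  fix z :: "real^'n"
  let ?B = "bubble p z"
  have B: "?B > 0" by (rule bubble_pos[OF p])
  have pw: "?B powr (q - 1) = ?B * ?B powr (q - 2)"
    using powr_mult_base[of ?B "q - 2"] B by simp
  have sq: "(\<Sum>i\<in>UNIV. (z $ i - p $ i)\<^sup>2) = ?B - (1 - (norm p)\<^sup>2)"
    unfolding bubble_def power2_norm_eq_inner[of "z - p"] by (simp add: inner_vec_def power2_eq_square)
  have "laplacian (\<lambda>z. bubble p z powr q) z = laplacian (beval p (BPow q)) z"
    by simp
  also have "\<dots> = (\<Sum>i\<in>UNIV. beval p (bderiv i (bderiv i (BPow q))) z)"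
    by (simp only: laplacian_def partial_beval[OF p])
  also have "\<dots> = (\<Sum>i\<in>UNIV. 2 * q * ?B powr (q - 1) + 4 * q * (q - 1) * ?B powr (q - 2) * (z $ i - p $ i)\<^sup>2)"
    by (intro sum.cong refl) (simp add: algebra_simps power2_eq_square)
  also have "\<dots> = CARD('n) * (2 * q * ?B powr (q - 1)) + 4 * q * (q - 1) * ?B powr (q - 2) * (?B - (1 - (norm p)\<^sup>2))"
    by (simp add: sum.distrib sum_distrib_left[symmetric] sq)
  also have "\<dots> = 2 * q * (2 * q - 2 + CARD('n)) * ?B powr (q - 1) +
         (- 4 * q * (q - 1) * (1 - (norm p)\<^sup>2)) * ?B powr (q - 2)"
    unfolding pw by (simp add: algebra_simps)
  finally show "laplacian (\<lambda>z. bubble p z powr q) z = \<dots>" .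
qed

text \<open>For natural \<open>q\<close> the power is a polynomial of degree 2q. The recursion would
  leave the natural exponents at \<open>q = 0\<close> and \<open>q = 1\<close>, but there the
  coefficients of the offending powers vanish.\<close>

lemma iter_laplacian_bubble_poly:
  fixes p :: "real^'n::finite"
  assumes p: "norm p < 1"
  shows "q < k \<Longrightarrow> iter_laplacian k (\<lambda>z. bubble p z powr real q) = (\<lambda>z. 0)"
proof (induction k arbitrary: q)
  case (Suc k)
  let ?b = "\<lambda>q z. bubble p z powr q"
  have eq: "iter_laplacian (Suc k) (?b (real q)) =
    (\<lambda>z. 2 * real q * (2 * real q - 2 + CARD('n)) * iter_laplacian k (?b (real q - 1)) z +
         (- 4 * real q * (real q - 1) * (1 - (norm p)\<^sup>2)) * iter_laplacian k (?b (real q - 2)) z)"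
    unfolding iter_laplacian_Suc' laplacian_bubble_powr[OF p]
    by (intro iter_laplacian_lincomb smooth_bubble_powr p)
  consider "q = 0" | "q = 1" | r where "q = Suc (Suc r)"
    by (metis One_nat_def not0_implies_Suc)
  then show ?case
  proof cases
    case 2
    then show ?thesis
      using Suc.IH[of 0] Suc.prems unfolding eq by simp
  next
    case (3 r)
    then show ?thesis
      using Suc.IH[of "Suc r"] Suc.IH[of r] Suc.prems unfolding eq by simp
  next
    case 1
    then show ?thesis unfolding eq by simp
  qed
qed simp

definition bubble_const :: "real \<Rightarrow> nat \<Rightarrow> real" where
  "bubble_const n k = (\<Prod>i<2 * k. n - 2 * real k + 2 * real i)"

lemma bubble_const_0: "bubble_const n 0 = 1"
  by (simp add: bubble_const_def)

text \<open>The factors run in steps of 2 from n - 2k to n + 2k - 2, so raising \<open>k\<close> by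
  one adds a factor at each end.\<close>

lemma bubble_const_Suc:
  "bubble_const n (Suc k) = (n - 2 * real k - 2) * bubble_const n k * (n + 2 * real k)"
proof -
  have "bubble_const n (Suc k) = (\<Prod>i<Suc (Suc (2 * k)). n - 2 * real (Suc k) + 2 * real i)"
    by (simp add: bubble_const_def)
  also have "\<dots> = (n - 2 * real (Suc k)) * (\<Prod>i<2 * k. n - 2 * real (Suc k) + 2 * real (Suc i))
      * (n - 2 * real (Suc k) + 2 * real (Suc (2 * k)))"
    unfolding prod.lessThan_Suc_shift[of _ "Suc (2 * k)"] by (simp add: prod.lessThan_Suc)
  finally show ?thesis
    by (simp add: bubble_const_def algebra_simps)
qed

lemma bubble_const_pos: "2 * real k < n \<Longrightarrow> 0 < bubble_const n k"
  unfolding bubble_const_def by (intro prod_pos) auto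

text \<open>The conformal identity \<open>\<Delta>\<^sup>k u\<^bsup>k-n/2\<^esup> = (-1)\<^sup>k c r\<^bsup>2k\<^esup> u\<^bsup>-k-n/2\<^esup>\<close>. One Laplacian of \<open>u\<^bsup>k-n/2\<^esup>\<close> is a combination of
  the powers belonging to \<open>k - 1\<close> and \<open>k - 2\<close>, hence the two-step induction, in which the intermediate
  powers cancel.\<close>

lemma iter_laplacian_bubble:
  fixes p :: "real^'n::finite"
  assumes p: "norm p < 1"
  defines "n \<equiv> real CARD('n)" and "\<delta> \<equiv> 1 - (norm p)\<^sup>2"
  shows "iter_laplacian k (\<lambda>z. bubble p z powr (real k - n / 2)) =
    (\<lambda>z. (-1) ^ k * bubble_const n k * \<delta> ^ k * bubble p z powr (- real k - n / 2))"
proof (induction k rule: induct_nat_012)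
  case 0
  show ?case by (simp add: bubble_const_0)
next
  case 1
  show ?case
    using laplacian_bubble_powr[OF p, of "1 - n / 2"]
    by (simp add: iter_laplacian_Suc bubble_const_Suc bubble_const_0 n_def \<delta>_def algebra_simps)
next
  case (ge2 k)
  let ?b = "\<lambda>q z. bubble p z powr q"
  let ?q = "real (Suc (Suc k)) - n / 2"
  let ?r = "- real k - n / 2"
  have "iter_laplacian (Suc (Suc k)) (?b ?q) =
    iter_laplacian (Suc k) (\<lambda>z. (2 * ?q * (2 * ?q - 2 + n)) * ?b (?q - 1) z + (- 4 * ?q * (?q - 1) * \<delta>) * ?b (?q - 2) z)"
    unfolding iter_laplacian_Suc'[of "Suc k"] laplacian_bubble_powr[OF p] n_def \<delta>_def ..
  also have "\<dots> = (\<lambda>z. (2 * ?q * (2 * ?q - 2 + n)) * iter_laplacian (Suc k) (?b (?q - 1)) z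
      + (- 4 * ?q * (?q - 1) * \<delta>) * iter_laplacian (Suc k) (?b (?q - 2)) z)"
    by (intro iter_laplacian_lincomb smooth_bubble_powr p)
  also have "?q - 1 = real (Suc k) - n / 2" by simp
  also have "?q - 2 = real k - n / 2" by simp
  also note ge2(2)
  \<comment> \<open>The hypothesis for \<open>k\<close> covers only \<open>k\<close> Laplacians of
    this power; the remaining one is applied to its right-hand side.\<close>
  also have "iter_laplacian (Suc k) (?b (real k - n / 2)) =
      (\<lambda>z. ((-1) ^ k * bubble_const n k * \<delta> ^ k) * laplacian (?b ?r) z)"
    unfolding iter_laplacian_Suc ge2(1)
    by (rule laplacian_cmult[OF smooth_bubble_powr[OF p]])
  also have "laplacian (?b ?r) = (\<lambda>z. (2 * ?r * (2 * ?r - 2 + n)) * ?b (- real (Suc k) - n / 2) z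
      + (- 4 * ?r * (?r - 1) * \<delta>) * ?b (- real (Suc (Suc k)) - n / 2) z)"
  proof -
    have "?r - 1 = - real (Suc k) - n / 2" "?r - 2 = - real (Suc (Suc k)) - n / 2" by simp_all
    then show ?thesis
      unfolding laplacian_bubble_powr[OF p] n_def \<delta>_def by metis
  qed
  finally have *: "iter_laplacian (Suc (Suc k)) (?b ?q) z =
      (2 * ?q * (2 * ?q - 2 + n)) * ((-1) ^ Suc k * bubble_const n (Suc k) * \<delta> ^ Suc k * ?b (- real (Suc k) - n / 2) z)
      + (- 4 * ?q * (real (Suc k) - n / 2) * \<delta>) * (((-1) ^ k * bubble_const n k * \<delta> ^ k) *
         ((2 * ?r * (2 * ?r - 2 + n)) * ?b (- real (Suc k) - n / 2) z
         + (- 4 * ?r * (?r - 1) * \<delta>) * ?b (- real (Suc (Suc k)) - n / 2) z))" for z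
    by (rule fun_cong[THEN trans]) simp
  show ?case
  proof
    fix z
    show "iter_laplacian (Suc (Suc k)) (?b ?q) z = (-1) ^ Suc (Suc k) * bubble_const n (Suc (Suc k)) * \<delta> ^ Suc (Suc k) *
      ?b (- real (Suc (Suc k)) - n / 2) z"
      unfolding * bubble_const_Suc by (simp add: field_simps)
  qed
qed

section \<open>Taylor estimates uniform in the centre of the bubble\<close>

lemma beval_bounded:
  "\<exists>C\<ge>0. \<forall>p z. norm p < 1 \<longrightarrow> norm z \<le> 1/2 \<longrightarrow> \<bar>beval p e z\<bar> \<le> C"
proof (induction e)
  case (BConst c)
  show ?case by (intro exI[of _ "\<bar>c\<bar>"]) auto
next
  case (BCoord i)
  have "\<bar>z $ i - p $ i\<bar> \<le> 2" if "norm p < 1" "norm z \<le> 1/2" for p z :: "real^'a"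
    using component_le_norm_cart[of z i] component_le_norm_cart[of p i] that by linarith
  then show ?case by (intro exI[of _ 2]) auto
next
  case (BPow q)
  have "\<bar>bubble p z powr q\<bar> \<le> 4 powr \<bar>q\<bar>" if "norm p < 1" "norm z \<le> 1/2" for p z :: "real^'a"
  proof (cases "q \<ge> 0")
    case True
    then show ?thesis
      using bubble_bounds[OF that] by (auto intro!: powr_mono2)
  next
    case False
    have "bubble p z powr q \<le> (1/4) powr q"
      using False bubble_bounds[OF that] by (intro powr_mono2') auto
    also have "(1/4 :: real) powr q = 4 powr (- q)"
      by (simp add: powr_divide powr_minus_divide)
    finally show ?thesis using False by simp
  qed
  then show ?case by (intro exI[of _ "4 powr \<bar>q\<bar>"]) auto
next
  case (BAdd a b)
  then obtain A B where "A \<ge> 0" "B \<ge> 0"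
    "\<And>p z. norm p < 1 \<Longrightarrow> norm z \<le> 1/2 \<Longrightarrow> \<bar>beval p a z\<bar> \<le> A"
    "\<And>p z. norm p < 1 \<Longrightarrow> norm z \<le> 1/2 \<Longrightarrow> \<bar>beval p b z\<bar> \<le> B"
    by blast
  then show ?case
    by (intro exI[of _ "A + B"]) (auto intro!: order_trans[OF abs_triangle_ineq] add_mono)
next
  case (BMul a b)
  then obtain A B where "A \<ge> 0" "B \<ge> 0"
    "\<And>p z. norm p < 1 \<Longrightarrow> norm z \<le> 1/2 \<Longrightarrow> \<bar>beval p a z\<bar> \<le> A"
    "\<And>p z. norm p < 1 \<Longrightarrow> norm z \<le> 1/2 \<Longrightarrow> \<bar>beval p b z\<bar> \<le> B"
    by blast
  then show ?case
    by (intro exI[of _ "A * B"]) (auto simp: abs_mult intro!: mult_mono)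
qed

text \<open>Only derivatives at the origin enter, and these are bounded uniformly in
  \<open>p\<close>. Thus \<open>z\<close> may be arbitrarily large, as the outer region
  requires.\<close>

lemma taylor_form_beval_bound:
  fixes e :: "'n::finite bexpr"
  shows "\<exists>C\<ge>0. \<forall>p z. norm p < 1 \<longrightarrow> \<bar>taylor_form k (beval p e) z\<bar> \<le> C * norm z ^ k"
proof (induction k arbitrary: e)
  case 0
  obtain C where "C \<ge> 0" "\<And>p z. norm p < 1 \<Longrightarrow> norm z \<le> 1/2 \<Longrightarrow> \<bar>beval p e z\<bar> \<le> C"
    using beval_bounded[of e] by blast
  then show ?case by (intro exI[of _ C]) auto
next
  case (Suc k)
  have "\<forall>i. \<exists>C. C \<ge> 0 \<and> (\<forall>p z. norm p < 1 \<longrightarrow> \<bar>taylor_form k (beval p (bderiv i e)) z\<bar> \<le> C * norm z ^ k)"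
    using Suc by blast
  from choice[OF this] obtain C where C: "\<And>i. C i \<ge> 0"
    "\<And>i p z. norm p < 1 \<Longrightarrow> \<bar>taylor_form k (beval p (bderiv i e)) z\<bar> \<le> C i * norm z ^ k"
    by blast
  have "\<bar>taylor_form (Suc k) (beval p e) z\<bar> \<le> (\<Sum>i\<in>UNIV. C i) * norm z ^ Suc k" if p: "norm p < 1" for p z
  proof -
    have "\<bar>taylor_form (Suc k) (beval p e) z\<bar> \<le> (\<Sum>i\<in>UNIV. \<bar>z $ i\<bar> * \<bar>taylor_form k (beval p (bderiv i e)) z\<bar>)"
      by (simp add: partial_beval[OF p] abs_mult[symmetric] sum_abs)
    also have "\<dots> \<le> (\<Sum>i\<in>UNIV. norm z * (C i * norm z ^ k))"
      by (intro sum_mono mult_mono C(2) p component_le_norm_cart) auto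
    finally show ?thesis
      by (simp add: sum_distrib_right sum_distrib_left mult_ac del: taylor_form.simps)
  qed
  then show ?case
    using C(1) by (intro exI[of _ "\<Sum>i\<in>UNIV. C i"]) (auto simp: sum_nonneg)
qed

lemma taylor_rem_0: "M > 0 \<Longrightarrow> taylor_rem M f 0 = 0"
proof -
  have "taylor_form k f 0 = 0" if "k > 0" for k
    using that by (cases k) auto
  then have "(\<Sum>k<M. taylor_form k f 0 / fact k) = f 0" if "M > 0"
    using that by (cases M) (auto simp: sum.lessThan_Suc_shift simp del: sum.lessThan_Suc intro!: sum.neutral)
  then show "M > 0 \<Longrightarrow> taylor_rem M f 0 = 0"
    by (simp add: taylor_rem_def)
qed

text \<open>Induction on the order by the mean value inequality on the ball of radius |z|: the
  remainder vanishes at 0, and its partials are remainders of order one less, already bounded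
  there.\<close>

lemma taylor_rem_beval_bound:
  fixes e :: "'n::finite bexpr"
  shows "\<exists>C\<ge>0. \<forall>p z. norm p < 1 \<longrightarrow> norm z \<le> 1/2 \<longrightarrow> \<bar>taylor_rem M (beval p e) z\<bar> \<le> C * norm z ^ M"
proof (induction M arbitrary: e)
  case 0
  show ?case using beval_bounded[of e] by (simp add: taylor_rem_def)
next
  case (Suc M)
  have "\<forall>i. \<exists>C. C \<ge> 0 \<and> (\<forall>p z. norm p < 1 \<longrightarrow> norm z \<le> 1/2 \<longrightarrow> \<bar>taylor_rem M (beval p (bderiv i e)) z\<bar> \<le> C * norm z ^ M)"
    using Suc by blast
  from choice[OF this] obtain C where C: "\<And>i. C i \<ge> 0"
    "\<And>i p z. norm p < 1 \<Longrightarrow> norm z \<le> 1/2 \<Longrightarrow> \<bar>taylor_rem M (beval p (bderiv i e)) z\<bar> \<le> C i * norm z ^ M"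
    by blast
  have "\<bar>taylor_rem (Suc M) (beval p e) z\<bar> \<le> (\<Sum>i\<in>UNIV. C i) * norm z ^ Suc M"
    if p: "norm p < 1" and z: "norm z \<le> 1/2" for p z
  proof -
    let ?B = "(\<Sum>i\<in>UNIV. C i) * norm z ^ M"
    have "norm (taylor_rem (Suc M) (beval p e) z - taylor_rem (Suc M) (beval p e) 0) \<le> ?B * norm (z - 0)"
    proof (rule differentiable_bound)
      show "convex (cball 0 (norm z) :: (real^'n) set)" by simp
      show "(taylor_rem (Suc M) (beval p e) has_derivative
          (\<lambda>h. \<Sum>j\<in>UNIV. h $ j * taylor_rem M (beval p (bderiv j e)) x)) (at x within cball 0 (norm z))" for x
        using has_derivative_taylor_rem[OF fsmooth_beval[OF p], of "Suc M" e x]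
        by (simp add: partial_beval[OF p] has_derivative_at_withinI)
      show "onorm (\<lambda>h. \<Sum>j\<in>UNIV. h $ j * taylor_rem M (beval p (bderiv j e)) x) \<le> ?B" if "x \<in> cball 0 (norm z)" for x
      proof (rule onorm_le)
        fix h :: "real^'n"
        have x: "norm x \<le> norm z" using that by simp
        have "norm (\<Sum>j\<in>UNIV. h $ j * taylor_rem M (beval p (bderiv j e)) x) \<le>
            (\<Sum>j\<in>UNIV. \<bar>h $ j\<bar> * \<bar>taylor_rem M (beval p (bderiv j e)) x\<bar>)"
          by (simp add: abs_mult[symmetric] sum_abs)
        also have "\<dots> \<le> (\<Sum>j\<in>UNIV. norm h * (C j * norm z ^ M))"
        proof (intro sum_mono mult_mono component_le_norm_cart)
          fix j
          have "\<bar>taylor_rem M (beval p (bderiv j e)) x\<bar> \<le> C j * norm x ^ M"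
            using x z by (intro C(2) p) auto
          also have "\<dots> \<le> C j * norm z ^ M"
            using x C(1) by (intro mult_left_mono power_mono) auto
          finally show "\<bar>taylor_rem M (beval p (bderiv j e)) x\<bar> \<le> C j * norm z ^ M" .
        qed auto
        finally show "norm (\<Sum>j\<in>UNIV. h $ j * taylor_rem M (beval p (bderiv j e)) x) \<le> ?B * norm h"
          by (simp add: sum_distrib_right sum_distrib_left mult_ac)
      qed
    qed auto
    then show ?thesis
      by (simp add: taylor_rem_0 mult_ac)
  qed
  then show ?case
    using C(1) by (intro exI[of _ "\<Sum>i\<in>UNIV. C i"]) (auto simp: sum_nonneg)
qed

lemma iter_partial_beval:
  "norm p < 1 \<Longrightarrow> iter_partial xs (beval p e) = beval p (foldr bderiv xs e)"
  by (induction xs) (auto simp: partial_beval)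

lemma iter_partial_taylor_rem_beval_bound:
  fixes e :: "'n::finite bexpr"
  shows "\<exists>C\<ge>0. \<forall>p z. norm p < 1 \<longrightarrow> norm z \<le> 1/2 \<longrightarrow>
    \<bar>iter_partial xs (taylor_rem M (beval p e)) z\<bar> \<le> C * norm z ^ (M - length xs)"
  using taylor_rem_beval_bound[of "M - length xs" "foldr bderiv xs e"]
  by (simp add: iter_partial_taylor_rem fsmooth_beval iter_partial_beval cong: conj_cong imp_cong)

text \<open>Near the origin this is the Taylor estimate. Farther out the function itself is kept and
  only its Taylor polynomial is estimated: as \<open>2 * norm z \<ge> 1\<close>, a form of degree k
  < M is at most a constant times |z|^M, which is the source of the factor
  \<open>2 ^ M\<close>.\<close>

lemma taylor_rem_beval_lower:
  fixes e :: "'n::finite bexpr"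
  shows "\<exists>C\<ge>0. \<forall>p z. norm p < 1 \<longrightarrow>
      (norm z \<le> 1/2 \<longrightarrow> - C * norm z ^ M \<le> taylor_rem M (beval p e) z) \<and>
      (norm z \<ge> 1/2 \<longrightarrow> beval p e z - C * norm z ^ M \<le> taylor_rem M (beval p e) z)"
proof -
  obtain A where A: "A \<ge> 0"
    "\<And>p z. norm p < 1 \<Longrightarrow> norm z \<le> 1/2 \<Longrightarrow> \<bar>taylor_rem M (beval p e) z\<bar> \<le> A * norm z ^ M"
    using taylor_rem_beval_bound[of M e] by blast
  have "\<forall>k. \<exists>C. C \<ge> 0 \<and> (\<forall>p z. norm p < 1 \<longrightarrow> \<bar>taylor_form k (beval p e) z\<bar> \<le> C * norm z ^ k)"
    using taylor_form_beval_bound[of _ e] by blast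
  from choice[OF this] obtain B where B: "\<And>k. B k \<ge> 0"
    "\<And>k p z. norm p < 1 \<Longrightarrow> \<bar>taylor_form k (beval p e) z\<bar> \<le> B k * norm z ^ k"
    by blast
  define C where "C = A + (\<Sum>k<M. B k * 2 ^ M)"
  have s: "(\<Sum>k<M. B k * 2 ^ M) \<ge> 0" using B(1) by (intro sum_nonneg) auto
  have "C \<ge> 0" unfolding C_def using s A(1) by auto
  moreover have "- C * norm z ^ M \<le> taylor_rem M (beval p e) z" if "norm p < 1" "norm z \<le> 1/2" for p z
  proof -
    have "A * norm z ^ M \<le> C * norm z ^ M"
      unfolding C_def using s by (intro mult_right_mono) auto
    then show ?thesis using A(2)[OF that] by auto
  qed
  moreover have "beval p e z - C * norm z ^ M \<le> taylor_rem M (beval p e) z"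
    if p: "norm p < 1" and z: "norm z \<ge> 1/2" for p z
  proof -
    have "(\<Sum>k<M. taylor_form k (beval p e) z / fact k) \<le> (\<Sum>k<M. B k * 2 ^ M * norm z ^ M)"
    proof (rule sum_mono)
      fix k assume "k \<in> {..<M}"
      then have k: "M = k + (M - k)" by simp
      have "taylor_form k (beval p e) z / fact k \<le> \<bar>taylor_form k (beval p e) z\<bar> / fact k"
        by (intro divide_right_mono) auto
      also have "\<dots> \<le> \<bar>taylor_form k (beval p e) z\<bar> / 1"
        by (intro divide_left_mono) (auto simp: fact_ge_1)
      also have "\<dots> \<le> B k * norm z ^ k * 1" using B(2)[OF p] by simp
      also have "\<dots> \<le> B k * norm z ^ k * (2 * norm z) ^ (M - k)"
        using z B(1) by (intro mult_left_mono one_le_power) auto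
      also have "\<dots> = B k * 2 ^ (M - k) * norm z ^ M"
        by (subst (2) k) (simp add: power_add power_mult_distrib)
      also have "\<dots> \<le> B k * 2 ^ M * norm z ^ M"
        using B(1) by (intro mult_right_mono mult_left_mono power_increasing) auto
      finally show "taylor_form k (beval p e) z / fact k \<le> B k * 2 ^ M * norm z ^ M" .
    qed
    also have "\<dots> = (\<Sum>k<M. B k * 2 ^ M) * norm z ^ M"
      by (simp add: sum_distrib_right)
    also have "\<dots> \<le> C * norm z ^ M"
      unfolding C_def using A(1) by (intro mult_right_mono) auto
    finally show ?thesis by (simp add: taylor_rem_def)
  qed
  ultimately show ?thesis by blast
qed

section \<open>The superposition\<close>

text \<open>The scaling computation that lets the width \<open>\<delta>\<close> be as small as the condition \<open>- \<Delta>\<^sup>m v \<le> v\<^bsup>\<lambda>\<^esup>\<close> permits.\<close>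

lemma rhs_bound:
  fixes \<epsilon> S D \<delta> K lam \<theta> n \<mu> M :: real
  assumes pos: "0 < \<epsilon>" "0 < S" "0 < \<delta>" and D: "\<delta>\<^sup>2 \<le> D" and \<theta>: "\<theta> = n - lam * (n - 2 * \<mu>)" "0 < \<theta>"
    and \<delta>: "\<delta> powr \<theta> = K * \<epsilon> powr (- lam) * S powr (- (2 + M * lam))"
  shows "K * S powr (- 2) * D powr (- n / 2) \<le> (\<epsilon> * S powr M * D powr (\<mu> - n / 2)) powr lam"
proof -
  have Dpos: "D > 0" using D pos by (smt (verit) zero_less_power)
  have "\<delta> powr \<theta> = (\<delta>\<^sup>2) powr (\<theta> / 2)"
    using pos by (simp add: powr_powr flip: powr_numeral)
  also have "\<dots> \<le> D powr (\<theta> / 2)"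
    using D \<theta> by (intro powr_mono2) auto
  finally have *: "\<delta> powr \<theta> \<le> D powr (\<theta> / 2)" .
  have "K * S powr (- 2) = \<delta> powr \<theta> * (\<epsilon> powr lam * S powr (M * lam))"
    unfolding \<delta> using pos by (simp add: field_simps flip: powr_add)
  also have "\<dots> \<le> D powr (\<theta> / 2) * (\<epsilon> powr lam * S powr (M * lam))"
    using * by (intro mult_right_mono) auto
  finally have "K * S powr (- 2) * D powr (- n / 2) \<le>
      D powr (\<theta> / 2) * (\<epsilon> powr lam * S powr (M * lam)) * D powr (- n / 2)"
    by (intro mult_right_mono) auto
  also have "\<dots> = \<epsilon> powr lam * S powr (M * lam) * D powr (\<theta> / 2 + - n / 2)"
    unfolding powr_add by simp
  also have "\<theta> / 2 + - n / 2 = (\<mu> - n / 2) * lam"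
    unfolding \<theta> by (simp add: field_simps)
  finally show ?thesis
    using pos Dpos by (simp add: powr_mult powr_powr)
qed

text \<open>This is where the exponent \<open>b\<close> comes from. The remaining factor is free of
  \<open>S\<close>, so the scale can afterwards be enlarged until \<open>\<phi>\<close> is small
  compared with that factor.\<close>

lemma peak_value:
  fixes \<epsilon> S \<delta> K lam \<theta> n \<mu> M b :: real
  assumes pos: "0 < \<epsilon>" "0 < S" "0 < \<delta>" "0 < K" and \<theta>: "\<theta> = n - lam * (n - 2 * \<mu>)" "0 < \<theta>"
    and \<delta>: "\<delta> powr \<theta> = K * S powr (- (2 + M * lam))"
    and M: "M = 2 * \<mu> - 2" and b: "b = 2 * \<mu> * (n - 2) / \<theta>"
  shows "\<epsilon> * S powr M * (\<delta>\<^sup>2) powr (\<mu> - n / 2) = \<epsilon> * K powr ((2 * \<mu> - n) / \<theta>) * S powr b"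
proof -
  let ?u = "(2 * \<mu> - n) / \<theta>"
  have "2 * (\<mu> - n / 2) = \<theta> * ?u"
    using \<theta>(2) by simp
  then have "(\<delta>\<^sup>2) powr (\<mu> - n / 2) = \<delta> powr (\<theta> * ?u)"
    using pos powr_powr[of \<delta> 2 "\<mu> - n / 2"] by simp
  also have "\<dots> = K powr ?u * S powr (- (2 + M * lam) * ?u)"
    unfolding powr_powr[symmetric] \<delta> using pos by (simp add: powr_mult)
  finally have "\<epsilon> * S powr M * (\<delta>\<^sup>2) powr (\<mu> - n / 2) =
      \<epsilon> * K powr ?u * S powr (M + - (2 + M * lam) * ?u)"
    by (simp add: powr_add)
  moreover have "M + - (2 + M * lam) * ?u = b"
  proof -
    have "M * \<theta> - (2 + M * lam) * (2 * \<mu> - n) = 2 * \<mu> * (n - 2)"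
      unfolding M \<theta> by (simp add: algebra_simps)
    then show ?thesis
      using \<theta>(2) unfolding b by (simp add: field_simps)
  qed
  ultimately show ?thesis by simp
qed

theorem theorem1p17:
  fixes m :: nat and lam b :: real and \<phi> :: "real \<Rightarrow> real"
  assumes "odd m" and "m \<ge> 3"
    and "2 * m < CARD('n::finite)"
    and "0 < lam" and "lam < real CARD('n) / (real CARD('n) - 2 * real m)"
    and "b = 2 * real m * (real CARD('n) - 2) / (real CARD('n) - lam * (real CARD('n) - 2 * real m))"
    and "continuous_on {1<..} \<phi>"
    and "\<And>r. r > 1 \<Longrightarrow> 0 < \<phi> r \<and> \<phi> r < 1"
    and "(\<phi> \<longlongrightarrow> 0) at_top"
  shows "\<exists>v :: real^'n \<Rightarrow> real.
           smooth_on (UNIV - {0}) v \<and>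
           (\<forall>y. y \<noteq> 0 \<longrightarrow> v y > 0) \<and>
           (\<forall>y. y \<noteq> 0 \<longrightarrow> 0 \<le> - iter_laplacian m v y \<and> - iter_laplacian m v y \<le> v y powr lam) \<and>
           Limsup at_infinity (\<lambda>y. ereal (v y / (\<phi> (norm y) * norm y powr b))) = \<infinity>"
proof -

  \<comment> \<open>Parameters and choice of scales\<close>
  define n where "n = real CARD('n)"
  define \<theta> where "\<theta> = n - lam * (n - 2 * real m)"
  \<comment> \<open>Polynomials of degree below \<open>M\<close> are killed by \<open>m\<close>
    Laplacians, and |x|^M is dominated by the polyharmonic polynomial (1 + |x|^2)^(m-1).\<close>
  define M where "M = 2 * m - 2"
  define E where "E = (BPow (real m - n / 2) :: 'n bexpr)"
  define k where "k = bubble_const n m"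
  define \<sigma> where "\<sigma> = 2 + real M * lam"
  \<comment> \<open>The weights sum to 1, so bounds proportional to them add up to a single
    copy.\<close>
  define \<epsilon> where "\<epsilon> j = (1 / 2 :: real) ^ Suc j" for j
  define K where "K j = k * \<epsilon> j powr (- lam)" for j
  define \<kappa> where "\<kappa> j = \<epsilon> j * K j powr ((2 * real m - n) / \<theta>)" for j
  \<comment> \<open>Solves the relation for the width demanded by \<open>rhs_bound\<close>. That
    estimate is an equality when \<open>D\<close> is the squared width, so it allows no narrower
    bubble.\<close>
  define \<Delta> where "\<Delta> j S = (K j * S powr (- \<sigma>)) powr (1 / \<theta>)" for j S
  have nm: "2 * real m < n" using assms(3) by (simp add: n_def)
  then have n2: "n > 2" using assms(2) by simp
  have \<theta>: "\<theta> > 0"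
    using assms(5) nm unfolding \<theta>_def n_def[symmetric] by (simp add: field_simps)
  have b: "b = 2 * real m * (n - 2) / \<theta>"
    unfolding \<theta>_def n_def by (rule assms(6))
  have b0: "b > 0" unfolding b using \<theta> n2 assms(2) by simp
  have \<sigma>: "\<sigma> > 0" unfolding \<sigma>_def using assms(4) by (simp add: add_pos_nonneg)
  have k: "k > 0" unfolding k_def by (rule bubble_const_pos[OF nm])
  have \<epsilon>: "\<epsilon> j > 0" for j by (simp add: \<epsilon>_def)
  have \<epsilon>_sums: "\<epsilon> sums 1"
    unfolding \<epsilon>_def by (rule power_half_series)
  have K: "K j > 0" for j unfolding K_def using k \<epsilon>[of j] by simp
  have \<kappa>: "\<kappa> j > 0" for j unfolding \<kappa>_def using \<epsilon>[of j] K[of j] by simp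

  \<comment> \<open>A width of at most 1/2 puts the norm of the peak between S/2 and S, and
    \<open>S > 2\<close> then places it outside the unit ball. The bound by
    \<open>real j + 1\<close> sends the peaks to infinity, the one on \<open>k * 2 powr n\<close>
    serves the region |x| < S/2, and \<open>\<phi>\<close> has to be small from S/2 onwards.\<close>
  have "\<exists>S. S > 2 \<and> S \<ge> real j + 1 \<and> k * 2 powr n \<le> S\<^sup>2 \<and> \<Delta> j S \<le> 1 / 2 \<and>
      (\<forall>r\<ge>S / 2. \<phi> r \<le> \<kappa> j / (real j + 1))" for j
  proof -
    have "((\<lambda>S. (K j * S powr (- \<sigma>)) powr (1 / \<theta>)) \<longlongrightarrow> (K j * 0) powr (1 / \<theta>)) at_top"
      using \<theta> \<sigma> K[of j]
      by (intro tendsto_powr2 tendsto_mult tendsto_const tendsto_neg_powr filterlim_ident) 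
        (auto intro!: always_eventually)
    then have "\<forall>\<^sub>F S in at_top. \<Delta> j S < 1 / 2"
      unfolding \<Delta>_def by (rule order_tendstoD(2)) simp
    moreover have "\<forall>\<^sub>F S in at_top. k * 2 powr n \<le> S\<^sup>2"
      using filterlim_pow_at_top[of 2 "\<lambda>x::real. x", OF _ filterlim_ident]
      by (simp add: filterlim_at_top)
    moreover have "\<forall>\<^sub>F S in at_top. \<forall>r\<ge>S / 2. \<phi> r \<le> \<kappa> j / (real j + 1)"
    proof -
      have "\<forall>\<^sub>F r in at_top. \<phi> r < \<kappa> j / (real j + 1)"
        using \<kappa>[of j] by (intro order_tendstoD(2)[OF assms(9)]) (simp add: add_nonneg_pos)
      then obtain R where "\<And>r. r \<ge> R \<Longrightarrow> \<phi> r < \<kappa> j / (real j + 1)"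
        by (auto simp: eventually_at_top_linorder)
      then show ?thesis
        by (intro eventually_at_top_linorderI[of "2 * R"]) (auto intro!: less_imp_le)
    qed
    moreover have "\<forall>\<^sub>F S in at_top. S > 2 \<and> S \<ge> real j + 1"
      by (intro eventually_conj eventually_gt_at_top eventually_ge_at_top)
    ultimately have "\<forall>\<^sub>F S in at_top. S > 2 \<and> S \<ge> real j + 1 \<and> k * 2 powr n \<le> S\<^sup>2 \<and> \<Delta> j S \<le> 1 / 2 \<and>
      (\<forall>r\<ge>S / 2. \<phi> r \<le> \<kappa> j / (real j + 1))"
      by eventually_elim auto
    then show ?thesis
      by (rule eventually_happens'[OF trivial_limit_at_top_linorder])
  qed
  then obtain S where S: "\<And>j. S j > 2" "\<And>j. S j \<ge> real j + 1" "\<And>j. k * 2 powr n \<le> (S j)\<^sup>2"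
      and \<Delta>_le: "\<And>j. \<Delta> j (S j) \<le> 1 / 2"
      and \<phi>_le: "\<And>j r. r \<ge> S j / 2 \<Longrightarrow> \<phi> r \<le> \<kappa> j / (real j + 1)"
    by metis
  define \<delta> where "\<delta> j = \<Delta> j (S j)" for j
  have S0: "S j > 0" for j using S(1)[of j] by simp
  have \<delta>: "\<delta> j > 0" "\<delta> j \<le> 1 / 2" "\<delta> j powr \<theta> = K j * S j powr (- \<sigma>)" for j
    using K[of j] S0[of j] \<Delta>_le[of j] \<theta> by (auto simp: \<delta>_def \<Delta>_def powr_powr)
  have \<delta>2: "(\<delta> j)\<^sup>2 \<le> 1 / 4" for j
    using power_mono[OF \<delta>(2)[of j], of 2] \<delta>(1)[of j] by (simp add: power2_eq_square)

  \<comment> \<open>The direction of the peaks is immaterial.\<close>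
  define i0 :: 'n where "i0 = undefined"
  \<comment> \<open>The minimum of \<open>bubble p\<close> is 1 - |p|^2, attained at
    \<open>p\<close>; this radius makes it the square of the chosen width.\<close>
  define a where "a j = sqrt (1 - (\<delta> j)\<^sup>2)" for j
  define p where "p j = a j *\<^sub>R axis i0 (1 :: real)" for j
  have a: "a j \<ge> 1 / 2" "a j < 1" "(a j)\<^sup>2 = 1 - (\<delta> j)\<^sup>2" for j
  proof -
    show "a j \<ge> 1 / 2" unfolding a_def
      by (rule real_le_rsqrt) (use \<delta>2[of j] in \<open>simp add: power2_eq_square\<close>)
    show "a j < 1" "(a j)\<^sup>2 = 1 - (\<delta> j)\<^sup>2"
      using \<delta>(1)[of j] \<delta>2[of j] by (auto simp: a_def)
  qed
  have norm_p: "norm (p j) = a j" for j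
    using a(1)[of j] by (simp add: p_def)
  have p: "norm (p j) < 1" for j by (simp add: norm_p a)
  have p\<delta>: "1 - (norm (p j))\<^sup>2 = (\<delta> j)\<^sup>2" for j by (simp add: norm_p a)

  \<comment> \<open>The rescaled remainders and the convergence of their series\<close>
  define c where "c j = \<epsilon> j * S j ^ M" for j
  define D where "D j x = bubble (p j) ((1 / S j) *\<^sub>R x)" for j x
  define h where "h j x = c j * taylor_rem M (beval (p j) E) ((1 / S j) *\<^sub>R x)" for j x
  have c: "c j > 0" for j by (simp add: c_def \<epsilon> S0)
  have c_powr: "c j = \<epsilon> j * S j powr real M" for j
    using S0[of j] by (simp add: c_def powr_realpow)
  have D: "(\<delta> j)\<^sup>2 \<le> D j x" for j x
    using bubble_ge[of "p j" "(1 / S j) *\<^sub>R x"] by (simp add: D_def p\<delta>)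
  have D0: "D j x > 0" for j x unfolding D_def by (rule bubble_pos[OF p])
  have sm_rem: "smooth_on UNIV (taylor_rem M (beval (p j) E))" for j
    by (intro fsmooth_imp_smooth iter_partial_taylor_rem(1) fsmooth_beval p)
  have h_eq: "h j = (\<lambda>x. c j * taylor_rem M (beval (p j) E) ((1 / S j) *\<^sub>R x))" for j
    by (auto simp: h_def)
  \<comment> \<open>The mass is normalised so that the scale drops out of the remainder estimates,
    leaving only the summable weight.\<close>
  have c_norm: "c j * norm ((1 / S j) *\<^sub>R x) ^ M = \<epsilon> j * norm x ^ M" for j x
    using S0[of j] by (simp add: c_def power_divide)

  have h_sum: "locally_summable h"
    unfolding locally_summable_def
  proof (intro conjI allI)
    show "smooth_on UNIV (h j)" for j
      unfolding h_eq by (rule smooth_dilate(1)[OF sm_rem])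
    fix xs :: "'n list" and \<rho> :: real
    obtain C where C: "C \<ge> 0" "\<And>p z. norm p < 1 \<Longrightarrow> norm z \<le> 1/2 \<Longrightarrow>
        \<bar>iter_partial xs (taylor_rem M (beval p E)) z\<bar> \<le> C * norm z ^ (M - length xs)"
      using iter_partial_taylor_rem_beval_bound[of xs M E] by blast
    let ?B = "\<lambda>j. \<epsilon> j * (C * (1 + \<bar>\<rho>\<bar>) ^ M)"
    have "summable ?B"
      using \<epsilon>_sums by (intro summable_mult2) (auto simp: sums_iff)
    moreover have "\<bar>iter_partial xs (h j) x\<bar> \<le> ?B j" if j: "real j \<ge> 2 * \<rho>" and x: "norm x \<le> \<rho>" for j x
    proof -
      let ?z = "(1 / S j) *\<^sub>R x"
      let ?l = "length xs"
      \<comment> \<open>For such \<open>j\<close> the growth of \<open>S j\<close> brings the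
        rescaled point into the half ball, where the bounds are uniform in \<open>p\<close>.\<close>
      have z: "norm ?z \<le> 1 / 2"
        using j x S(2)[of j] S0[of j] by (simp add: field_simps)
      have "\<bar>iter_partial xs (h j) x\<bar> = c j * (1 / S j) ^ ?l * \<bar>iter_partial xs (taylor_rem M (beval (p j) E)) ?z\<bar>"
        unfolding h_eq smooth_dilate(2)[OF sm_rem] abs_mult using c[of j] S0[of j] by simp
      also have "\<dots> \<le> c j * (1 / S j) ^ ?l * (C * norm ?z ^ (M - ?l))"
        using c[of j] S0[of j] by (intro mult_left_mono C(2) p z) auto
      also have "\<dots> = \<epsilon> j * (C * (S j ^ M * (1 / S j) ^ ?l * norm ?z ^ (M - ?l)))"
        by (simp add: c_def)
      also have "\<dots> \<le> ?B j"
      proof (intro mult_left_mono C(1) less_imp_le[OF \<epsilon>])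
        show "S j ^ M * (1 / S j) ^ ?l * norm ?z ^ (M - ?l) \<le> (1 + \<bar>\<rho>\<bar>) ^ M"
        proof (cases "?l \<le> M")
          case True
          then have "S j ^ M = S j ^ ?l * S j ^ (M - ?l)"
            by (simp flip: power_add)
          then have "S j ^ M * (1 / S j) ^ ?l * norm ?z ^ (M - ?l) = norm x ^ (M - ?l)"
            using S0[of j] by (simp add: power_divide)
          also have "\<dots> \<le> (1 + \<bar>\<rho>\<bar>) ^ (M - ?l)"
            using x by (intro power_mono) auto
          also have "\<dots> \<le> (1 + \<bar>\<rho>\<bar>) ^ M"
            by (intro power_increasing) auto
          finally show ?thesis .
        next
          \<comment> \<open>Beyond order \<open>M\<close> the remainder bound has no decay left, but
            each further derivative gains a factor \<open>1 / S j\<close>, which is below 1.\<close>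
          case False
          then have "S j ^ M * (1 / S j) ^ ?l * norm ?z ^ (M - ?l) = S j ^ M / S j ^ ?l"
            by (simp add: power_divide)
          also have "\<dots> \<le> 1"
            using False S(1)[of j] by (simp add: power_increasing)
          also have "\<dots> \<le> (1 + \<bar>\<rho>\<bar>) ^ M" by simp
          finally show ?thesis .
        qed
      qed
      finally show ?thesis .
    qed
    moreover have "\<forall>\<^sub>F j in sequentially. real j \<ge> 2 * \<rho>"
      using filterlim_real_sequentially by (simp add: filterlim_at_top)
    ultimately show "\<exists>M. summable M \<and>
        (\<forall>\<^sub>F j in sequentially. \<forall>x. norm x \<le> \<rho> \<longrightarrow> \<bar>iter_partial xs (h j) x\<bar> \<le> M j)"
      by (intro exI[of _ ?B] conjI) (auto elim: eventually_mono)
  qed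
  have h_summable: "summable (\<lambda>j. h j x)" for x
    using locally_summable_uniform(2)[OF h_sum, of "[]"] by simp

  \<comment> \<open>The iterated Laplacians of the terms\<close>
  define f where "f j x = c j * (1 / S j) ^ (2 * m) * (k * ((\<delta> j)\<^sup>2) ^ m * D j x powr (- real m - n / 2))" for j x
  have lap_h: "iter_laplacian m (h j) x = - f j x" for j x
  proof -
    \<comment> \<open>Truncated subtraction: the order drops to 0, and \<open>taylor_rem 0\<close>
      subtracts nothing.\<close>
    have "M - 2 * m = 0" by (simp add: M_def)
    then have "iter_laplacian m (taylor_rem M (beval (p j) E)) = iter_laplacian m (beval (p j) E)"
      by (subst iter_laplacian_taylor_rem) (auto simp: fsmooth_beval p taylor_rem_def)
    also have "\<dots> = (\<lambda>z. (-1) ^ m * k * ((\<delta> j)\<^sup>2) ^ m * bubble (p j) z powr (- real m - n / 2))"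
      unfolding E_def beval.simps n_def iter_laplacian_bubble[OF p] p\<delta> k_def ..
    \<comment> \<open>Oddness of \<open>m\<close> turns (-1)^m into the minus sign.\<close>
    finally show ?thesis
      unfolding h_eq iter_laplacian_dilate[OF sm_rem] using assms(1) by (simp add: f_def D_def)
  qed
  have f_nonneg: "f j x \<ge> 0" for j x
    using c[of j] S0[of j] k by (simp add: f_def)
  have f_le: "f j x \<le> \<epsilon> j * (k * S j powr (- 2) * D j x powr (- n / 2))" for j x
  proof -
    \<comment> \<open>As \<open>D\<close> is at least the squared width, this factor from the
      conformal identity is at most 1, with equality at the centre.\<close>
    have "((\<delta> j)\<^sup>2) ^ m * D j x powr (- real m) \<le> D j x ^ m * D j x powr (- real m)"
      using D by (intro mult_right_mono power_mono) auto
    also have "\<dots> = 1"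
      using D0[of j x] by (simp add: powr_minus powr_realpow)
    finally have *: "((\<delta> j)\<^sup>2) ^ m * D j x powr (- real m) \<le> 1" .
    have cS: "c j * (1 / S j) ^ (2 * m) = \<epsilon> j * S j powr (- 2)"
    proof -
      have "2 * m = M + 2" using assms(2) by (simp add: M_def)
      then show ?thesis
        using S0[of j] by (simp add: c_def powr_minus power_divide power_add power2_eq_square field_simps)
    qed
    have "D j x powr (- real m - n / 2) = D j x powr (- real m) * D j x powr (- n / 2)"
      by (simp flip: powr_add)
    then have "f j x = \<epsilon> j * (k * S j powr (- 2) * D j x powr (- n / 2)) * (((\<delta> j)\<^sup>2) ^ m * D j x powr (- real m))"
      unfolding f_def cS by simp
    also have "\<dots> \<le> \<epsilon> j * (k * S j powr (- 2) * D j x powr (- n / 2)) * 1"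
      using * \<epsilon>[of j] k by (intro mult_left_mono) auto
    finally show ?thesis by simp
  qed

  \<comment> \<open>Far from the origin, relative to the scale \<open>S j\<close>, the Taylor polynomial is dominated by \<open>|x|\<^bsup>2m-2\<^esup>\<close>; near
    the origin it is not, but there the remainder itself is small.\<close>
  obtain C where C: "C \<ge> 0"
      "\<And>p z. norm p < 1 \<Longrightarrow> norm z \<le> 1/2 \<Longrightarrow> - C * norm z ^ M \<le> taylor_rem M (beval p E) z"
      "\<And>p z. norm p < 1 \<Longrightarrow> norm z \<ge> 1/2 \<Longrightarrow> beval p E z - C * norm z ^ M \<le> taylor_rem M (beval p E) z"
    using taylor_rem_beval_lower[of M E] by blast
  have far: "h j x \<ge> c j * D j x powr (real m - n / 2) - \<epsilon> j * (C * norm x ^ M)"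
    if "norm ((1 / S j) *\<^sub>R x) \<ge> 1 / 2" for j x
  proof -
    have "c j * (beval (p j) E ((1 / S j) *\<^sub>R x) - C * norm ((1 / S j) *\<^sub>R x) ^ M) \<le> h j x"
      unfolding h_def using c[of j] by (intro mult_left_mono C(3) p that) auto
    moreover have "c j * (C * norm ((1 / S j) *\<^sub>R x) ^ M) = \<epsilon> j * (C * norm x ^ M)"
      using c_norm[of j x] by (metis mult.left_commute)
    ultimately show ?thesis
      by (simp add: E_def D_def right_diff_distrib del: norm_scaleR)
  qed
  have low: "h j x \<ge> - (\<epsilon> j * (C * norm x ^ M))" for j x
  proof (cases "norm ((1 / S j) *\<^sub>R x) \<ge> 1 / 2")
    case True
    have "c j * D j x powr (real m - n / 2) \<ge> 0" using c[of j] by simp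
    then show ?thesis using far[OF True] by linarith
  next
    case False
    have "c j * (- C * norm ((1 / S j) *\<^sub>R x) ^ M) \<le> h j x"
      unfolding h_def using c[of j] False by (intro mult_left_mono C(2) p) auto
    moreover have "c j * (C * norm ((1 / S j) *\<^sub>R x) ^ M) = \<epsilon> j * (C * norm x ^ M)"
      using c_norm[of j x] by (metis mult.left_commute)
    ultimately show ?thesis by (simp del: norm_scaleR)
  qed

  \<comment> \<open>The solution and its lower bounds\<close>
  define P where "P x = (C + 1) * bubble 0 x powr real (m - 1)" for x :: "real^'n"
  define v where "v x = P x + (\<Sum>j. h j x)" for x
  \<comment> \<open>The part C |x|^M pays for the negative parts of all terms together, and the
    spare 1 gives \<open>v\<close> a positive lower bound.\<close>
  have P_ge: "P x \<ge> C * norm x ^ M + 1" for x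
  proof -
    have "P x = (C + 1) * (1 + (norm x)\<^sup>2) ^ (m - 1)"
      unfolding P_def by (subst powr_realpow) (auto simp: bubble_def add_pos_nonneg)
    moreover have "(1 + (norm x)\<^sup>2) ^ (m - 1) \<ge> ((norm x)\<^sup>2) ^ (m - 1)"
      by (intro power_mono) auto
    moreover have "((norm x)\<^sup>2) ^ (m - 1) = norm x ^ M"
      by (simp add: M_def power_mult[symmetric] right_diff_distrib')
    moreover have "(1 + (norm x)\<^sup>2) ^ (m - 1) \<ge> 1"
      by (rule one_le_power) simp
    ultimately show ?thesis
      using C(1) by (simp add: distrib_right add_mono mult_left_mono)
  qed
  have eps_sums: "(\<lambda>j. \<epsilon> j * t) sums t" for t
    using sums_mult2[OF \<epsilon>_sums, of t] by simp
  have v1: "v x \<ge> 1" for x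
  proof -
    have "- (C * norm x ^ M) \<le> (\<Sum>j. h j x)"
      using low by (intro sums_le[OF _ sums_minus[OF eps_sums] summable_sums[OF h_summable]]) auto
    then show ?thesis using P_ge[of x] by (simp add: v_def)
  qed
  \<comment> \<open>Only the \<open>j\<close>-th bubble is kept. Every term, the \<open>j\<close>-th
    included, loses at most its share of C |x|^M, and \<open>P\<close> repays the total.\<close>
  have v2: "v x \<ge> c j * D j x powr (real m - n / 2)" if "norm ((1 / S j) *\<^sub>R x) \<ge> 1 / 2" for j x
  proof -
    let ?w = "c j * D j x powr (real m - n / 2)"
    have "(\<lambda>i. if i = j then ?w else 0) sums ?w"
      by (rule sums_single)
    then have "(\<lambda>i. (if i = j then ?w else 0) + - (\<epsilon> i * (C * norm x ^ M))) sums (?w + - (C * norm x ^ M))"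
      by (intro sums_add sums_minus eps_sums)
    then have "?w + - (C * norm x ^ M) \<le> (\<Sum>j. h j x)"
      by (rule sums_le[rotated, OF _ summable_sums[OF h_summable]]) (use low far[OF that] in auto)
    then show ?thesis using P_ge[of x] by (simp add: v_def)
  qed
  have v_powr: "v x powr lam \<ge> 1" for x
    using v1[of x] assms(4) by (simp add: ge_one_powr_ge_zero)
  \<comment> \<open>Away from the origin \<open>v\<close> is at least this very bubble and
    \<open>rhs_bound\<close> applies. Near it the bubble function is at least 1/4, so the choice of
    \<open>S j\<close> makes the term at most \<open>\<epsilon> j\<close>, while
    \<open>v x powr lam\<close> is at least 1.\<close>
  have f_v: "f j x \<le> \<epsilon> j * v x powr lam" for j x
  proof (cases "norm ((1 / S j) *\<^sub>R x) \<ge> 1 / 2")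
    case True
    have "k * S j powr (- 2) * D j x powr (- n / 2) \<le> (\<epsilon> j * S j powr real M * D j x powr (real m - n / 2)) powr lam"
      by (rule rhs_bound[OF \<epsilon> S0 \<delta>(1) D \<theta>_def \<theta>])
        (simp add: \<delta>(3) K_def \<sigma>_def)
    also have "\<dots> \<le> v x powr lam"
      using v2[OF True] assms(4) \<epsilon>[of j] unfolding c_powr by (intro powr_mono2) auto
    finally show ?thesis
      using f_le[of j x] \<epsilon>[of j] by (meson mult_left_mono less_imp_le order_trans)
  next
    case False
    have "1 / 4 \<le> D j x"
      unfolding D_def using False by (intro bubble_bounds p) auto
    then have "D j x powr (- n / 2) \<le> (1 / 4) powr (- n / 2)"
      using n2 by (intro powr_mono2') auto
    also have "(1 / 4 :: real) powr (- n / 2) = 2 powr n"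
    proof -
      have "(1 / 4 :: real) = 2 powr (- 2)" by (simp add: powr_minus)
      then show ?thesis by (simp only: powr_powr) simp
    qed
    finally have "k * S j powr (- 2) * D j x powr (- n / 2) \<le> k * S j powr (- 2) * 2 powr n"
      using k by (intro mult_left_mono) auto
    also have "\<dots> = k * 2 powr n / (S j)\<^sup>2"
      using S0[of j] by (simp add: powr_minus divide_inverse)
    also have "\<dots> \<le> 1"
      using S(3)[of j] S0[of j] by simp
    also have "\<dots> \<le> v x powr lam" by (rule v_powr)
    finally show ?thesis
      using f_le[of j x] \<epsilon>[of j] by (meson mult_left_mono less_imp_le order_trans)
  qed

  \<comment> \<open>Smoothness and the differential inequality\<close>
  have sm_b: "smooth_on UNIV (\<lambda>x::real^'n. bubble 0 x powr real (m - 1))"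
    by (rule smooth_bubble_powr) simp
  have v_eq: "v = (\<lambda>x. (C + 1) * bubble 0 x powr real (m - 1) + 1 * (\<Sum>j. h j x))"
    by (auto simp: v_def P_def)
  have sm_v: "smooth_on UNIV v"
    unfolding v_eq by (intro smooth_lincomb(1) sm_b smooth_suminf(1) h_sum)
  have lap_v: "- iter_laplacian m v x = (\<Sum>j. f j x)" and f_summable: "summable (\<lambda>j. f j x)" for x
  proof -
    \<comment> \<open>The correction is a multiple of the power \<open>m - 1\<close> of a bubble
      centred at 0, hence polyharmonic of order \<open>m\<close>.\<close>
    have "iter_laplacian m (\<lambda>x::real^'n. bubble 0 x powr real (m - 1)) = (\<lambda>x. 0)"
      using assms(2) by (intro iter_laplacian_bubble_poly) auto
    then have "iter_laplacian m v x = (\<Sum>j. - f j x)"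
      unfolding v_eq iter_laplacian_lincomb[OF sm_b smooth_suminf(1)[OF h_sum]]
        iter_laplacian_suminf(1)[OF h_sum] lap_h by simp
    moreover show "summable (\<lambda>j. f j x)"
      using iter_laplacian_suminf(2)[OF h_sum, of m x] unfolding lap_h by (simp add: summable_minus_iff)
    ultimately show "- iter_laplacian m v x = (\<Sum>j. f j x)"
      by (simp add: suminf_minus)
  qed
  have lap_bounds: "0 \<le> - iter_laplacian m v x" "- iter_laplacian m v x \<le> v x powr lam" for x
  proof -
    show "0 \<le> - iter_laplacian m v x"
      unfolding lap_v by (intro suminf_nonneg f_summable f_nonneg)
    show "- iter_laplacian m v x \<le> v x powr lam"
      unfolding lap_v by (intro sums_le[OF f_v summable_sums[OF f_summable] eps_sums])
  qed

  \<comment> \<open>Growth along the peaks\<close>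
  have peak: "\<exists>y. norm y \<ge> (real j + 1) / 2 \<and> v y / (\<phi> (norm y) * norm y powr b) \<ge> real j + 1" for j
  proof -
    \<comment> \<open>The centre of the \<open>j\<close>-th bubble in the original variable, where
      \<open>D j\<close> attains its minimum.\<close>
    define y where "y = S j *\<^sub>R p j"
    have z: "(1 / S j) *\<^sub>R y = p j"
      using S0[of j] by (simp add: y_def)
    have ny: "norm y = S j * a j"
      using S0[of j] by (simp add: y_def norm_p)
    then have ny2: "norm y \<ge> S j / 2" "norm y \<le> S j"
      using a(1,2)[of j] S0[of j] by (simp_all add: field_simps)
    then have ny1: "norm y > 1" using S(1)[of j] by linarith
    have "D j y = (\<delta> j)\<^sup>2"
      unfolding D_def z by (simp add: bubble_def p\<delta>)
    then have "v y \<ge> \<epsilon> j * S j powr real M * ((\<delta> j)\<^sup>2) powr (real m - n / 2)"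
      using v2[of j y] a(1)[of j] unfolding z c_powr norm_p by simp
    also have "\<epsilon> j * S j powr real M * ((\<delta> j)\<^sup>2) powr (real m - n / 2) = \<kappa> j * S j powr b"
      unfolding \<kappa>_def
    proof (rule peak_value[OF \<epsilon> S0 \<delta>(1) K \<theta>_def \<theta> _ _ b])
      show "\<delta> j powr \<theta> = K j * S j powr (- (2 + real M * lam))"
        by (simp add: \<delta>(3) \<sigma>_def)
      show "real M = 2 * real m - 2"
        using assms(2) by (simp add: M_def of_nat_diff)
    qed
    finally have vy: "v y \<ge> \<kappa> j * S j powr b" .
    \<comment> \<open>The scale was chosen with \<open>\<phi>\<close> smaller than the peak constant
      by the factor 1/(j+1) there; this factor makes the ratio unbounded.\<close>
    have "(real j + 1) * (\<phi> (norm y) * norm y powr b) \<le> (real j + 1) * (\<kappa> j / (real j + 1) * S j powr b)"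
      using ny1 ny2 b0 assms(8)[OF ny1] \<kappa>[of j]
      by (intro mult_left_mono mult_mono \<phi>_le powr_mono2) auto
    also have "\<dots> = \<kappa> j * S j powr b"
      by (simp add: add_eq_0_iff_both_eq_0)
    finally have "(real j + 1) * (\<phi> (norm y) * norm y powr b) \<le> v y"
      using vy by linarith
    moreover have "\<phi> (norm y) * norm y powr b > 0"
      using assms(8)[OF ny1] ny1 by (intro mult_pos_pos) auto
    ultimately have "v y / (\<phi> (norm y) * norm y powr b) \<ge> real j + 1"
      by (simp add: pos_le_divide_eq)
    moreover have "norm y \<ge> (real j + 1) / 2"
      by (rule order_trans[OF _ ny2(1)]) (use S(2)[of j] in simp)
    ultimately show ?thesis by blast
  qed
  have "Limsup at_infinity (\<lambda>y. ereal (v y / (\<phi> (norm y) * norm y powr b))) = \<infinity>"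
  proof (rule ccontr)
    assume "Limsup at_infinity (\<lambda>y. ereal (v y / (\<phi> (norm y) * norm y powr b))) \<noteq> \<infinity>"
    then obtain r where "Limsup at_infinity (\<lambda>y. ereal (v y / (\<phi> (norm y) * norm y powr b))) < ereal r"
      using less_PInf_Ex_of_nat by blast
    then have "\<forall>\<^sub>F y in at_infinity. ereal (v y / (\<phi> (norm y) * norm y powr b)) < ereal r"
      by (rule Limsup_lessD)
    then obtain R where R: "\<And>y. norm y \<ge> R \<Longrightarrow> v y / (\<phi> (norm y) * norm y powr b) < r"
      by (auto simp: eventually_at_infinity)
    \<comment> \<open>Such a \<open>j\<close> places the peak beyond radius \<open>R\<close> with a
      ratio exceeding \<open>r\<close>.\<close>
    obtain j where j: "real j \<ge> max (2 * R) r"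
      using real_arch_simple by blast
    obtain y where "norm y \<ge> (real j + 1) / 2" "v y / (\<phi> (norm y) * norm y powr b) \<ge> real j + 1"
      using peak by blast
    then show False
      using R[of y] j by simp
  qed
  moreover have "smooth_on (UNIV - {0}) v"
    using sm_v unfolding smooth_on_def by (auto intro: continuous_on_subset simp del: iter_partial.simps)
  moreover have "v y > 0" for y
    using v1[of y] by linarith
  ultimately show ?thesis
    using lap_bounds by blast
qed

end
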